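(* Strongly compactifiable, compactifiable, strongly Polishable, and Polishable classes are stable under countable unions. That is, for each of these four properties, if $(\mathcal{C}_n)_{n}$ is a countable collection of classes of topological spaces each having the property, then $\bigcup_{n}\mathcal{C}_n$ has the same property.
   Context: A metrizable compactum is a compact metrizable space; the empty space is allowed (also as a Polish space). Two classes $\mathcal{C},\mathcal{D}$ of topological spaces (not necessarily closed under homeomorphic copies) are equivalent, written $\mathcal{C}\cong\mathcal{D}$, if every space in $\mathcal{C}$ is homeomorphic to a space in $\mathcal{D}$ and vice versa. A family of subsets of a topological space is regarded as a class of topological spaces by giving each member the subspace topology. A class $\mathcal{C}$ is compactifiable (resp. Polishable) if there is a continuous map $q\colon A\to B$ between metrizable compacta (resp. Polish spaces) such that $\{q^{-1}(b): b\in B\}\cong\mathcal{C}$; it is strongly compactifiable (resp. strongly Polishable) if moreover $q$ can be chosen to be a closed and open map with $|B\setminus q[A]|\le 1$. *)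

theory Defs
  imports "HOL-Analysis.Analysis"
begin

definition metrizable_compactum :: "'a topology \<Rightarrow> bool" where
  "metrizable_compactum X \<longleftrightarrow> metrizable_space X \<and> compact_space X"

definition polish_space :: "'a topology \<Rightarrow> bool" where
  "polish_space X \<longleftrightarrow> completely_metrizable_space X \<and> separable_space X"

definition equivalent_classes :: "'a topology set \<Rightarrow> 'b topology set \<Rightarrow> bool" where
  "equivalent_classes \<C> \<D> \<longleftrightarrow>
     (\<forall>X\<in>\<C>. \<exists>Y\<in>\<D>. X homeomorphic_space Y) \<and> (\<forall>Y\<in>\<D>. \<exists>X\<in>\<C>. Y homeomorphic_space X)"

text \<open>The index \<open>b\<close> ranges over all of \<open>B\<close>, so if \<open>q\<close> is not onto then the
  empty space is among the fibres.\<close>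

definition fibres :: "'a topology \<Rightarrow> 'b topology \<Rightarrow> ('a \<Rightarrow> 'b) \<Rightarrow> 'a topology set" where
  "fibres A B q = (\<lambda>b. subtopology A {a \<in> topspace A. q a = b}) ` topspace B"

text \<open>\<open>finite\<close> is needed because \<open>card\<close> of an infinite set is \<open>0\<close>.\<close>

definition strong_map :: "'a topology \<Rightarrow> 'b topology \<Rightarrow> ('a \<Rightarrow> 'b) \<Rightarrow> bool" where
  "strong_map A B q \<longleftrightarrow> closed_map A B q \<and> open_map A B q \<and>
     finite (topspace B - q ` topspace A) \<and> card (topspace B - q ` topspace A) \<le> 1"

text \<open>Types cannot be quantified existentially, so the spaces \<open>A\<close> and \<open>B\<close> below have
  real numbers as points. Their topologies are arbitrary, unrelated to the usual topology of
  the real line. This is no restriction: every separable metrizable space has at most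
  continuum many points and so has a homeomorphic copy of this form
  (\<open>separable_metrizable_real_copy\<close>). The introduction rules at the end of
  this theory admit \<open>A\<close> and \<open>B\<close> over arbitrary types.\<close>

definition compactifiable :: "'a topology set \<Rightarrow> bool" where
  "compactifiable \<C> \<longleftrightarrow>
     (\<exists>(A :: real topology) (B :: real topology) q.
        metrizable_compactum A \<and> metrizable_compactum B \<and> continuous_map A B q \<and>
        equivalent_classes (fibres A B q) \<C>)"

definition strongly_compactifiable :: "'a topology set \<Rightarrow> bool" where
  "strongly_compactifiable \<C> \<longleftrightarrow>
     (\<exists>(A :: real topology) (B :: real topology) q.
        metrizable_compactum A \<and> metrizable_compactum B \<and> continuous_map A B q \<and>
        strong_map A B q \<and> equivalent_classes (fibres A B q) \<C>)"

definition Polishable :: "'a topology set \<Rightarrow> bool" where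
  "Polishable \<C> \<longleftrightarrow>
     (\<exists>(A :: real topology) (B :: real topology) q.
        polish_space A \<and> polish_space B \<and> continuous_map A B q \<and>
        equivalent_classes (fibres A B q) \<C>)"

definition strongly_Polishable :: "'a topology set \<Rightarrow> bool" where
  "strongly_Polishable \<C> \<longleftrightarrow>
     (\<exists>(A :: real topology) (B :: real topology) q.
        polish_space A \<and> polish_space B \<and> continuous_map A B q \<and>
        strong_map A B q \<and> equivalent_classes (fibres A B q) \<C>)"

lemma separable_metrizable_real_copy:
  fixes X :: "'a topology"
  assumes "metrizable_space X" "separable_space X"
  shows "\<exists>Y :: real topology. X homeomorphic_space Y"
proof -
  obtain M d where M: "Metric_space M d" and X: "X = Metric_space.mtopology M d"
    using assms(1) unfolding metrizable_space_def by blast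
  interpret Metric_space M d by (rule M)
  have tX: "topspace X = M" by (simp add: X)
  obtain D where D: "countable D" "D \<subseteq> M" "X closure_of D = M"
    using assms(2) unfolding separable_space_def tX by blast
  define N where "N x = {(z, n). z \<in> D \<and> x \<in> mball z (inverse (Suc n))}" for x
  have injN: "inj_on N M"
  proof (rule inj_onI, rule ccontr)
    fix x y assume xy: "x \<in> M" "y \<in> M" "N x = N y" "x \<noteq> y"
    then have "d x y > 0" by simp
    then obtain n where n: "inverse (real (Suc n)) < d x y / 2"
      using reals_Archimedean[of "d x y / 2"] by auto
    have "x \<in> mtopology closure_of D" using xy D X by simp
    then obtain z where z: "z \<in> D" "z \<in> mball x (inverse (Suc n))"
    proof -
      have "\<forall>r>0. \<exists>z\<in>D. z \<in> mball x r"
        using \<open>x \<in> mtopology closure_of D\<close> unfolding metric_closure_of by blast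
      moreover have "inverse (real (Suc n)) > 0" by simp
      ultimately show thesis using that by blast
    qed
    then have "(z, n) \<in> N x" using D by (auto simp: N_def commute)
    then have "(z, n) \<in> N y" using xy by simp
    then have "d z y < inverse (Suc n)" "d x z < inverse (Suc n)"
      using z by (auto simp: N_def)
    moreover have "d x y \<le> d x z + d z y" using triangle xy z D by blast
    ultimately show False using n by linarith
  qed
  have "countable (D \<times> (UNIV :: nat set))" using D by simp
  then obtain e :: "'a \<times> nat \<Rightarrow> nat" where e: "inj_on e (D \<times> UNIV)"
    unfolding countable_def by blast
  have "inj_on (\<lambda>x. e ` N x) M"
  proof (rule inj_onI)
    fix x y assume xy: "x \<in> M" "y \<in> M" "e ` N x = e ` N y"
    have "N x \<subseteq> D \<times> UNIV" "N y \<subseteq> D \<times> UNIV" by (auto simp: N_def)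
    then have "N x = N y" using inj_on_image_eq_iff[OF e] xy by blast
    then show "x = y" using injN xy by (auto dest: inj_onD)
  qed
  then have "M \<lesssim> (UNIV :: nat set set)" unfolding lepoll_def by blast
  then have "M \<lesssim> (UNIV :: real set)"
    using nat_sets_eqpoll_reals lepoll_trans2 by blast
  then obtain f :: "'a \<Rightarrow> real" where f: "inj_on f M" unfolding lepoll_def by blast
  define g where "g = inv_into M f"
  have gf: "g (f x) = x" if "x \<in> M" for x using f that by (simp add: g_def)
  define Y where "Y = pullback_topology (f ` M) g X"
  have tY: "topspace Y = f ` M" using gf by (auto simp: Y_def topspace_pullback_topology tX)
  have "continuous_map Y X (id \<circ> g)" unfolding Y_def
    by (rule continuous_map_pullback) simp
  moreover have "continuous_map X Y f" unfolding Y_def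
  proof (rule continuous_map_pullback')
    show "continuous_map X X (g \<circ> f)"
      by (rule continuous_map_eq[OF continuous_map_id]) (simp add: tX gf)
  qed (auto simp: tX)
  ultimately have "homeomorphic_maps X Y f g"
    unfolding homeomorphic_maps_def using gf by (auto simp: tX tY)
  then show ?thesis unfolding homeomorphic_space_def by blast
qed

lemma metrizable_compactum_separable:
  assumes "metrizable_compactum X"
  shows "separable_space X"
proof -
  obtain M d where M: "Metric_space M d" and X: "X = Metric_space.mtopology M d"
    using assms unfolding metrizable_compactum_def metrizable_space_def by blast
  interpret Metric_space M d by (rule M)
  have "mtotally_bounded M"
    using assms compact_space_eq_mcomplete_mtotally_bounded X
    by (auto simp: metrizable_compactum_def)
  then have "\<exists>K. finite K \<and> K \<subseteq> M \<and> M \<subseteq> (\<Union>x\<in>K. mball x (inverse (Suc n)))" for n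
    unfolding mtotally_bounded_def by (metis inverse_positive_iff_positive of_nat_0_less_iff zero_less_Suc)
  then obtain K where K: "\<And>n. finite (K n)" "\<And>n. K n \<subseteq> M"
      "\<And>n. M \<subseteq> (\<Union>x\<in>K n. mball x (inverse (Suc n)))"
    by metis
  define D where "D = (\<Union>n. K n)"
  have "x \<in> mtopology closure_of D" if x: "x \<in> M" for x
    unfolding metric_closure_of
  proof (clarsimp simp: x)
    fix r :: real assume "0 < r"
    then obtain n where n: "inverse (real (Suc n)) < r" using reals_Archimedean by blast
    obtain z where "z \<in> K n" "x \<in> mball z (inverse (Suc n))" using K(3)[of n] x by blast
    then show "\<exists>y\<in>D. y \<in> M \<and> d x y < r"
      using n K(2) by (intro bexI[of _ z]) (auto simp: D_def commute)
  qed
  then have "X closure_of D = topspace X"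
    using closure_of_subset_topspace[of mtopology D] by (auto simp: X)
  moreover have "countable D" "D \<subseteq> topspace X"
    using K by (auto simp: D_def X countable_finite)
  ultimately show ?thesis unfolding separable_space_def by blast
qed

lemma transfer_to_real:
  fixes A :: "'x topology" and B :: "'y topology" and \<C> :: "'a topology set"
  assumes A: "metrizable_space A" "separable_space A"
    and B: "metrizable_space B" "separable_space B"
    and q: "continuous_map A B q" and eq: "equivalent_classes (fibres A B q) \<C>"
  obtains A' B' :: "real topology" and q'
  where "A homeomorphic_space A'" "B homeomorphic_space B'" "continuous_map A' B' q'"
    "equivalent_classes (fibres A' B' q') \<C>" "strong_map A B q \<Longrightarrow> strong_map A' B' q'"
proof -
  obtain A' :: "real topology" and h h' where h: "homeomorphic_maps A A' h h'"
    using separable_metrizable_real_copy[OF A] unfolding homeomorphic_space_def by blast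
  obtain B' :: "real topology" and k k' where k: "homeomorphic_maps B B' k k'"
    using separable_metrizable_real_copy[OF B] unfolding homeomorphic_space_def by blast
  have hm: "homeomorphic_map A A' h" "homeomorphic_map A' A h'"
    using h homeomorphic_maps_map by blast+
  have km: "homeomorphic_map B B' k" "homeomorphic_map B' B k'"
    using k homeomorphic_maps_map by blast+
  have im: "h ` topspace A = topspace A'" "h' ` topspace A' = topspace A"
      "k ` topspace B = topspace B'" "k' ` topspace B' = topspace B"
    using hm km homeomorphic_imp_surjective_map by blast+
  have kk: "\<And>b. b \<in> topspace B \<Longrightarrow> k' (k b) = b" "\<And>b. b \<in> topspace B' \<Longrightarrow> k (k' b) = b"
    and hh: "\<And>b. b \<in> topspace A \<Longrightarrow> h' (h b) = b"
    using h k by (auto simp: homeomorphic_maps_def)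
  have qi: "\<And>a. a \<in> topspace A \<Longrightarrow> q a \<in> topspace B"
    using q by (auto simp: continuous_map_def)
  define q' where "q' = k \<circ> (q \<circ> h')"
  have c: "continuous_map A' B' q'" unfolding q'_def
    by (intro continuous_map_compose[of _ A] continuous_map_compose[of _ B] q
          homeomorphic_imp_continuous_map hm km)
  define F where "F b = subtopology A {a \<in> topspace A. q a = b}" for b
  define F' where "F' b = subtopology A' {a \<in> topspace A'. q' a = b}" for b
  have F: "F b homeomorphic_space F' (k b)" if b: "b \<in> topspace B" for b
  proof -
    have "h ` (topspace A \<inter> {a \<in> topspace A. q a = b})
        = topspace A' \<inter> {a \<in> topspace A'. q' a = k b}"
    proof (intro subset_antisym subsetI)
      fix y assume y: "y \<in> topspace A' \<inter> {a \<in> topspace A'. q' a = k b}"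
      then obtain a where a: "a \<in> topspace A" "y = h a" using im by blast
      then have "k (q a) = k b" using y hh by (simp add: q'_def)
      then have "q a = b" using kk qi a b by metis
      then show "y \<in> h ` (topspace A \<inter> {a \<in> topspace A. q a = b})" using a by blast
    qed (use im hh in \<open>auto simp: q'_def\<close>)
    then have "homeomorphic_map (F b) (F' (k b)) h"
      unfolding F_def F'_def by (intro homeomorphic_map_subtopologies hm) auto
    then show ?thesis using homeomorphic_map_imp_homeomorphic_space by blast
  qed
  have fib: "fibres A B q = F ` topspace B" "fibres A' B' q' = (\<lambda>b. F' (k b)) ` topspace B"
    unfolding fibres_def F_def F'_def im(3)[symmetric] by (auto simp: image_image)
  have "equivalent_classes (fibres A' B' q') \<C>"
    unfolding equivalent_classes_def
  proof (intro conjI ballI)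
    fix X assume "X \<in> fibres A' B' q'"
    then obtain b where "b \<in> topspace B" "X = F' (k b)" using fib by auto
    then show "\<exists>Y\<in>\<C>. X homeomorphic_space Y"
      using eq F homeomorphic_space_sym homeomorphic_space_trans
      unfolding equivalent_classes_def fib by (metis imageI)
  next
    fix Y assume "Y \<in> \<C>"
    then obtain b where "b \<in> topspace B" "Y homeomorphic_space F b"
      using eq unfolding equivalent_classes_def fib by blast
    then show "\<exists>X\<in>fibres A' B' q'. Y homeomorphic_space X"
      using F homeomorphic_space_trans unfolding fib by blast
  qed
  moreover have "strong_map A' B' q'" if s: "strong_map A B q"
  proof -
    have "closed_map A' B' q'" unfolding q'_def
      using s unfolding strong_map_def
      by (blast intro: closed_map_compose[of A' B _ B'] closed_map_compose[of A' A _ B]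
          homeomorphic_imp_closed_map[OF hm(2)] homeomorphic_imp_closed_map[OF km(1)])
    moreover have "open_map A' B' q'" unfolding q'_def
      using s unfolding strong_map_def
      by (blast intro: open_map_compose[of A' B _ B'] open_map_compose[of A' A _ B]
          homeomorphic_imp_open_map[OF hm(2)] homeomorphic_imp_open_map[OF km(1)])
    moreover have sub: "topspace B' - q' ` topspace A' \<subseteq> k ` (topspace B - q ` topspace A)"
    proof
      fix y assume y: "y \<in> topspace B' - q' ` topspace A'"
      have "q' ` topspace A' = k ` q ` topspace A"
        unfolding q'_def by (simp only: image_comp[symmetric] im)
      then show "y \<in> k ` (topspace B - q ` topspace A)" using y unfolding im(3)[symmetric] by blast
    qed
    moreover have fin: "finite (topspace B - q ` topspace A)"
      and "card (topspace B - q ` topspace A) \<le> 1" using s by (auto simp: strong_map_def)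
    then have "card (topspace B' - q' ` topspace A') \<le> 1"
      using card_mono[OF finite_imageI[OF fin] sub] card_image_le[OF fin, of k] by linarith
    ultimately show ?thesis
      unfolding strong_map_def using finite_subset[OF sub] finite_imageI[OF fin] by auto
  qed
  ultimately show thesis
    using that c h k unfolding homeomorphic_space_def by blast
qed

lemma homeomorphic_metrizable_compactum:
  "X homeomorphic_space Y \<Longrightarrow> metrizable_compactum X \<Longrightarrow> metrizable_compactum Y"
  unfolding metrizable_compactum_def
  using homeomorphic_metrizable_space homeomorphic_compact_space by blast

lemma homeomorphic_polish_space:
  "X homeomorphic_space Y \<Longrightarrow> polish_space X \<Longrightarrow> polish_space Y"
  unfolding polish_space_def
  using homeomorphic_completely_metrizable_space homeomorphic_separable_space by blast

lemma metrizable_compactum_imp: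
  assumes "metrizable_compactum X"
  shows "metrizable_space X" "separable_space X"
  using assms metrizable_compactum_separable by (auto simp: metrizable_compactum_def)

lemma polish_space_imp:
  assumes "polish_space X"
  shows "metrizable_space X" "separable_space X"
  using assms completely_metrizable_imp_metrizable_space by (auto simp: polish_space_def)

lemma compactifiableI:
  fixes A :: "'x topology" and B :: "'y topology"
  assumes A: "metrizable_compactum A" and B: "metrizable_compactum B" and q: "continuous_map A B q"
    and eq: "equivalent_classes (fibres A B q) \<C>"
  shows "compactifiable \<C>"
proof (rule transfer_to_real[OF metrizable_compactum_imp[OF A] metrizable_compactum_imp[OF B] q eq])
  fix A' B' :: "real topology" and q'
  assume hom: "A homeomorphic_space A'" "B homeomorphic_space B'"
    and q': "continuous_map A' B' q'" "equivalent_classes (fibres A' B' q') \<C>"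
    and s': "strong_map A B q \<Longrightarrow> strong_map A' B' q'"
  show "compactifiable \<C>"
    unfolding compactifiable_def
    using homeomorphic_metrizable_compactum[OF hom(1) A] homeomorphic_metrizable_compactum[OF hom(2) B] q' by blast
qed

lemma strongly_compactifiableI:
  fixes A :: "'x topology" and B :: "'y topology"
  assumes A: "metrizable_compactum A" and B: "metrizable_compactum B" and q: "continuous_map A B q"
    and s: "strong_map A B q"
    and eq: "equivalent_classes (fibres A B q) \<C>"
  shows "strongly_compactifiable \<C>"
proof (rule transfer_to_real[OF metrizable_compactum_imp[OF A] metrizable_compactum_imp[OF B] q eq])
  fix A' B' :: "real topology" and q'
  assume hom: "A homeomorphic_space A'" "B homeomorphic_space B'"
    and q': "continuous_map A' B' q'" "equivalent_classes (fibres A' B' q') \<C>"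
    and s': "strong_map A B q \<Longrightarrow> strong_map A' B' q'"
  show "strongly_compactifiable \<C>"
    unfolding strongly_compactifiable_def
    using homeomorphic_metrizable_compactum[OF hom(1) A] homeomorphic_metrizable_compactum[OF hom(2) B] q' s'[OF s] by blast
qed

lemma PolishableI:
  fixes A :: "'x topology" and B :: "'y topology"
  assumes A: "polish_space A" and B: "polish_space B" and q: "continuous_map A B q"
    and eq: "equivalent_classes (fibres A B q) \<C>"
  shows "Polishable \<C>"
proof (rule transfer_to_real[OF polish_space_imp[OF A] polish_space_imp[OF B] q eq])
  fix A' B' :: "real topology" and q'
  assume hom: "A homeomorphic_space A'" "B homeomorphic_space B'"
    and q': "continuous_map A' B' q'" "equivalent_classes (fibres A' B' q') \<C>"
    and s': "strong_map A B q \<Longrightarrow> strong_map A' B' q'"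
  show "Polishable \<C>"
    unfolding Polishable_def
    using homeomorphic_polish_space[OF hom(1) A] homeomorphic_polish_space[OF hom(2) B] q' by blast
qed

lemma strongly_PolishableI:
  fixes A :: "'x topology" and B :: "'y topology"
  assumes A: "polish_space A" and B: "polish_space B" and q: "continuous_map A B q"
    and s: "strong_map A B q"
    and eq: "equivalent_classes (fibres A B q) \<C>"
  shows "strongly_Polishable \<C>"
proof (rule transfer_to_real[OF polish_space_imp[OF A] polish_space_imp[OF B] q eq])
  fix A' B' :: "real topology" and q'
  assume hom: "A homeomorphic_space A'" "B homeomorphic_space B'"
    and q': "continuous_map A' B' q'" "equivalent_classes (fibres A' B' q') \<C>"
    and s': "strong_map A B q \<Longrightarrow> strong_map A' B' q'"
  show "strongly_Polishable \<C>"
    unfolding strongly_Polishable_def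
    using homeomorphic_polish_space[OF hom(1) A] homeomorphic_polish_space[OF hom(2) B] q' s'[OF s] by blast
qed

end

theory Submission
  imports Defs
begin

text \<open>
  The Polish cases are topological sums: a countable sum of Polish spaces is Polish, and the sum
  of closed and open maps is closed and open (\<open>strong_map_sum_topology\<close>). Only the points missed by
  the maps have to be watched. The image of a closed and open map is clopen, so each target can be cut
  down to the image, and the empty spaces are supplied by one extra summand.

  For compacta the infinite sum has to be compactified, and the new fibres must be spaces of the
  given class. In the compactifiable case the compositions are shrunk to one point of a nonempty
  fibre \<open>F\<close> of one of them; the only new fibre is a copy of \<open>F\<close> (\<open>null_sequence_of_families\<close>).

  In the strongly compactifiable case the map must also be open at the new fibre \<open>F\<close>. For this the
  nearby fibres have to be placed in a normed space so that they converge to \<open>F\<close> in the Hausdorff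
  distance. Not every compactum has continuous images that approximate a given \<open>F\<close>: a connected
  space cannot approximate two points, and a one-point space cannot approximate an interval. But
  this depends only on crude data. A compactum with infinitely many components approximates every
  nonempty compactum, and one with \<open>c\<close> components, \<open>j\<close> of them nondegenerate, approximates each
  compactum with \<open>c' \<le> c\<close> components, \<open>j' \<le> j\<close> of them nondegenerate, since a nondegenerate
  continuum maps onto an interval and an interval maps to a path along any continuum. Pairs of
  natural numbers have finitely many minimal elements in any set, so finitely many members of the
  class can be chosen such that every member approximates one of them arbitrarily well
  (\<open>finitely_many_limits\<close>). These serve as the new fibres.

  An approximation by one fibre extends to the nearby fibres by Tietze's theorem, because the map is
  closed and open (\<open>approximation_near_fibre\<close>). By compactness each base is therefore covered by
  finitely many closed pieces, over each of which all fibres approximate the same limit with a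
  prescribed error. Letting the error tend to zero with \<open>n\<close>, all pieces with the same limit \<open>F\<close>
  shrink to \<open>F\<close> in one composition, and finally the finitely many compositions so obtained are summed.
\<close>

section \<open>Topological sums of Polish spaces and of metrizable compacta\<close>

lemma metrizable_compactum_closedin:
  "metrizable_compactum X \<Longrightarrow> closedin X S \<Longrightarrow> metrizable_compactum (subtopology X S)"
  unfolding metrizable_compactum_def
  by (auto intro: metrizable_space_subtopology compact_space_subtopology closedin_compact_space)

lemma polish_space_clopenin:
  "polish_space X \<Longrightarrow> closedin X S \<Longrightarrow> openin X S \<Longrightarrow> polish_space (subtopology X S)"
  unfolding polish_space_def
  by (auto intro: completely_metrizable_space_closedin separable_space_open_subset)

text \<open>Metrics bounded by \<open>1\<close> extend to a metric on the disjoint union by putting different summands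
  at distance \<open>1\<close>. Balls of radius at most \<open>1\<close> then stay in one summand, which gives the sum
  topology, and a Cauchy sequence is eventually in one summand, which gives completeness. The condition \<open>i \<in> I\<close> is there
  because a metric has to be nonnegative and symmetric outside its carrier too, and nothing is known
  about \<open>d i\<close> for other \<open>i\<close>.\<close>

lemma sum_metric:
  fixes I :: "'i set" and M :: "'i \<Rightarrow> 'b set"
  assumes M: "\<And>i. i \<in> I \<Longrightarrow> Metric_space (M i) (d i)"
    and bound: "\<And>i x y. i \<in> I \<Longrightarrow> x \<in> M i \<Longrightarrow> y \<in> M i \<Longrightarrow> d i x y \<le> 1"
  defines "D \<equiv> \<lambda>(i, x) (j, y). if i = j \<and> i \<in> I then d i x y else 1"
  shows "Metric_space (Sigma I M) D"
    and "Metric_space.mtopology (Sigma I M) D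
          = sum_topology (\<lambda>i. Metric_space.mtopology (M i) (d i)) I"
    and "(\<And>i. i \<in> I \<Longrightarrow> Metric_space.mcomplete (M i) (d i))
          \<Longrightarrow> Metric_space.mcomplete (Sigma I M) D"
proof -
  show S: "Metric_space (Sigma I M) D"
  proof
    fix p p' p'' :: "'i \<times> 'b"
    show "0 \<le> D p p'" using Metric_space.nonneg[OF M] by (auto simp: D_def split: prod.splits)
    show "D p p' = D p' p" using Metric_space.commute[OF M] by (auto simp: D_def split: prod.splits)
    assume "p \<in> Sigma I M" "p' \<in> Sigma I M"
    then show "D p p' = 0 \<longleftrightarrow> p = p'"
      using Metric_space.zero[OF M] by (auto simp: D_def split: if_splits)
    assume "p'' \<in> Sigma I M"
    with \<open>p \<in> Sigma I M\<close> \<open>p' \<in> Sigma I M\<close> show "D p p'' \<le> D p p' + D p' p''"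
      using Metric_space.triangle[OF M] Metric_space.nonneg[OF M] bound order_trans[OF bound one_le_numeral]
      by (auto simp: D_def add_increasing add_increasing2)
  qed
  then interpret S: Metric_space "Sigma I M" D .
  have D: "D (i, x) (j, y) = (if i = j \<and> i \<in> I then d i x y else 1)" for i j x y
    by (simp add: D_def)
  have ball: "S.mball (i, x) r = Pair i ` Metric_space.mball (M i) (d i) x r"
    if "i \<in> I" "x \<in> M i" "r \<le> 1" for i x r
  proof -
    have "p \<in> S.mball (i, x) r \<longleftrightarrow> p \<in> Pair i ` Metric_space.mball (M i) (d i) x r" for p
      using that Metric_space.in_mball[OF M[OF that(1)], of "snd p" x r]
      by (cases p) (auto simp: S.in_mball D image_iff split: if_splits)
    then show ?thesis by blast
  qed
  show top: "S.mtopology = sum_topology (\<lambda>i. Metric_space.mtopology (M i) (d i)) I"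
    unfolding topology_eq
  proof
    fix U
    have "(\<forall>p\<in>U. \<exists>r>0. S.mball p r \<subseteq> U) \<longleftrightarrow>
      (\<forall>i\<in>I. \<forall>x. (i, x) \<in> U \<longrightarrow> (\<exists>r>0. Metric_space.mball (M i) (d i) x r \<subseteq> {y. (i, y) \<in> U}))"
      (is "?l \<longleftrightarrow> ?r") if U: "U \<subseteq> Sigma I M"
    proof
      assume ?l
      show ?r
      proof (intro ballI allI impI)
        fix i x assume ix: "i \<in> I" "(i, x) \<in> U"
        then obtain r where r: "r > 0" "S.mball (i, x) r \<subseteq> U" using \<open>?l\<close> by blast
        then have "S.mball (i, x) (min r 1) \<subseteq> U"
          using S.mball_subset_concentric[of "min r 1" r] by auto
        then show "\<exists>r>0. Metric_space.mball (M i) (d i) x r \<subseteq> {y. (i, y) \<in> U}"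
          using ball[of i x "min r 1"] ix U r by (intro exI[of _ "min r 1"]) auto
      qed
    next
      assume ?r
      show ?l
      proof (intro ballI)
        fix p assume p: "p \<in> U"
        obtain i x where ix: "p = (i, x)" "i \<in> I" "x \<in> M i" using U p by auto
        then obtain r where r: "r > 0" "Metric_space.mball (M i) (d i) x r \<subseteq> {y. (i, y) \<in> U}"
          using \<open>?r\<close> p by blast
        then have "Metric_space.mball (M i) (d i) x (min r 1) \<subseteq> {y. (i, y) \<in> U}"
          using Metric_space.mball_subset_concentric[OF M[OF ix(2)], of "min r 1" r] by auto
        then show "\<exists>r>0. S.mball p r \<subseteq> U"
          using ball[of i x "min r 1"] ix r by (intro exI[of _ "min r 1"]) auto
      qed
    qed
    then show "openin S.mtopology U \<longleftrightarrow>
        openin (sum_topology (\<lambda>i. Metric_space.mtopology (M i) (d i)) I) U"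
      unfolding S.openin_mtopology openin_sum_topology
      by (auto simp: Metric_space.openin_mtopology[OF M] Metric_space.topspace_mtopology[OF M]
            cong: conj_cong) blast+
  qed
  show "S.mcomplete" if comp: "\<And>i. i \<in> I \<Longrightarrow> Metric_space.mcomplete (M i) (d i)"
    unfolding S.mcomplete_def
  proof (intro allI impI)
    fix \<sigma> assume \<sigma>: "S.MCauchy \<sigma>"
    then obtain N where N: "\<And>n n'. N \<le> n \<Longrightarrow> N \<le> n' \<Longrightarrow> D (\<sigma> n) (\<sigma> n') < 1"
      unfolding S.MCauchy_def by (metis zero_less_one)
    have inS: "\<sigma> n \<in> Sigma I M" for n using \<sigma> by (auto simp: S.MCauchy_def)
    define i where "i = fst (\<sigma> N)"
    have fst: "fst (\<sigma> n) = i" if "N \<le> n" for n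
      using N[of N n] that by (auto simp: D_def i_def split: if_splits prod.splits)
    have i: "i \<in> I" using inS[of N] by (auto simp: i_def)
    interpret Mi: Metric_space "M i" "d i" using M[OF i] .
    have D\<sigma>: "D (\<sigma> n) (\<sigma> n') = d i (snd (\<sigma> n)) (snd (\<sigma> n'))" if "N \<le> n" "N \<le> n'" for n n'
      using fst that i by (auto simp: D_def split: prod.splits) (metis fst_conv)+
    have "Mi.MCauchy (\<lambda>n. snd (\<sigma> (N + n)))"
      unfolding Mi.MCauchy_def
    proof (intro conjI allI impI)
      have "snd (\<sigma> (N + n)) \<in> M i" for n using inS[of "N + n"] fst[of "N + n"] by auto
      then show "range (\<lambda>n. snd (\<sigma> (N + n))) \<subseteq> M i" by auto
      fix e :: real assume "e > 0"
      then obtain K where "\<And>n n'. K \<le> n \<Longrightarrow> K \<le> n' \<Longrightarrow> D (\<sigma> n) (\<sigma> n') < e"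
        using \<sigma> unfolding S.MCauchy_def by metis
      then show "\<exists>K. \<forall>n n'. K \<le> n \<longrightarrow> K \<le> n' \<longrightarrow> d i (snd (\<sigma> (N + n))) (snd (\<sigma> (N + n'))) < e"
        by (metis D\<sigma> le_add1 trans_le_add2)
    qed
    then obtain x where x: "limitin Mi.mtopology (\<lambda>n. snd (\<sigma> (N + n))) x sequentially"
      using comp[OF i] unfolding Mi.mcomplete_def by blast
    have "(\<lambda>n. \<sigma> (N + n)) = Pair i \<circ> (\<lambda>n. snd (\<sigma> (N + n)))"
      using fst by (auto simp: prod_eq_iff)
    then have "limitin S.mtopology (\<lambda>n. \<sigma> (n + N)) (i, x) sequentially"
      unfolding top
      using continuous_map_limit[OF continuous_map_component_injection[OF i],
          where f = "\<lambda>n. snd (\<sigma> (N + n))" and l = x] x by (simp add: add.commute)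
    then show "\<exists>x. limitin S.mtopology \<sigma> x sequentially"
      using limitin_sequentially_offset_rev[of S.mtopology \<sigma> N] by blast
  qed
qed

lemma sum_topology_cong:
  assumes eq: "\<And>i. i \<in> I \<Longrightarrow> X i = Y i"
  shows "sum_topology X I = sum_topology Y I"
proof -
  have "Sigma I (topspace \<circ> X) = Sigma I (topspace \<circ> Y)"
    by (rule Sigma_cong) (simp_all add: eq)
  moreover have "(\<forall>i\<in>I. openin (X i) {x. (i, x) \<in> U}) \<longleftrightarrow> (\<forall>i\<in>I. openin (Y i) {x. (i, x) \<in> U})" for U
    by (simp add: eq)
  ultimately show ?thesis unfolding sum_topology_def by (simp only:)
qed

lemma completely_metrizable_space_sum_topology:
  assumes "\<And>i. i \<in> I \<Longrightarrow> completely_metrizable_space (X i)"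
  shows "completely_metrizable_space (sum_topology X I)"
proof -
  obtain M d where Md: "\<And>i. i \<in> I \<Longrightarrow> Metric_space (M i) (d i)"
    "\<And>i. i \<in> I \<Longrightarrow> Metric_space.mcomplete (M i) (d i)"
    "\<And>i. i \<in> I \<Longrightarrow> X i = Metric_space.mtopology (M i) (d i)"
    using assms unfolding completely_metrizable_space_def by metis
  define c where "c i = Metric_space.capped_dist (d i) 1" for i
  have c: "Metric_space (M i) (c i)" "Metric_space.mcomplete (M i) (c i)"
    "X i = Metric_space.mtopology (M i) (c i)" "c i x y \<le> 1" if "i \<in> I" for i x y
    using Md[OF that] Metric_space.capped_dist[OF Md(1)[OF that], of 1]
      Metric_space.mcomplete_capped_metric[OF Md(1)[OF that], of 1]
      Metric_space.mtopology_capped_metric[OF Md(1)[OF that], of 1]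
      Metric_space.capped_dist_def[OF Md(1)[OF that]]
    by (simp_all add: c_def)
  have "sum_topology X I = sum_topology (\<lambda>i. Metric_space.mtopology (M i) (c i)) I"
    by (rule sum_topology_cong) (rule c(3))
  moreover have "completely_metrizable_space (sum_topology (\<lambda>i. Metric_space.mtopology (M i) (c i)) I)"
    unfolding completely_metrizable_space_def
  proof (intro exI conjI)
    show "Metric_space (Sigma I M) (\<lambda>(i, x) (j, y). if i = j \<and> i \<in> I then c i x y else 1)"
      by (rule sum_metric(1)) (simp_all add: c)
    show "Metric_space.mcomplete (Sigma I M) (\<lambda>(i, x) (j, y). if i = j \<and> i \<in> I then c i x y else 1)"
      by (rule sum_metric(3)) (simp_all add: c)
    show "sum_topology (\<lambda>i. Metric_space.mtopology (M i) (c i)) I = Metric_space.mtopology (Sigma I M)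
        (\<lambda>(i, x) (j, y). if i = j \<and> i \<in> I then c i x y else 1)"
      by (rule sum_metric(2)[symmetric]) (simp_all add: c)
  qed
  ultimately show ?thesis by (simp only:)
qed

lemma separable_space_sum_topology:
  assumes "countable I" "\<And>i. i \<in> I \<Longrightarrow> separable_space (X i)"
  shows "separable_space (sum_topology X I)"
proof -
  obtain D where D: "\<And>i. i \<in> I \<Longrightarrow> countable (D i)" "\<And>i. i \<in> I \<Longrightarrow> D i \<subseteq> topspace (X i)"
    "\<And>i. i \<in> I \<Longrightarrow> X i closure_of D i = topspace (X i)"
    using assms(2) unfolding separable_space_def by metis
  have "sum_topology X I closure_of Sigma I D = topspace (sum_topology X I)"
  proof (intro subset_antisym closure_of_subset_topspace subsetI)
    fix p assume p: "p \<in> topspace (sum_topology X I)"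
    then obtain i x where ix: "p = (i, x)" "i \<in> I" "x \<in> topspace (X i)" by auto
    then have x: "x \<in> X i closure_of D i" using D by auto
    have "\<exists>y \<in> Sigma I D. y \<in> T" if T: "p \<in> T" "openin (sum_topology X I) T" for T
    proof -
      have "openin (X i) {y. (i, y) \<in> T}" using T ix by (auto simp: openin_sum_topology)
      then obtain y where "y \<in> D i" "(i, y) \<in> T"
        using x T ix unfolding in_closure_of by auto
      then show ?thesis using ix by blast
    qed
    then show "p \<in> sum_topology X I closure_of Sigma I D"
      using p unfolding in_closure_of by blast
  qed
  moreover have "countable (Sigma I D)" using assms(1) D by auto
  moreover have "Sigma I D \<subseteq> topspace (sum_topology X I)" using D(2) by (simp add: Sigma_mono comp_def)
  ultimately show ?thesis unfolding separable_space_def by blast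
qed

lemma compact_space_sum_topology:
  assumes "finite I" "\<And>i. i \<in> I \<Longrightarrow> compact_space (X i)"
  shows "compact_space (sum_topology X I)"
proof -
  have "compactin (sum_topology X I) (\<Union>i\<in>I. Pair i ` topspace (X i))"
    using assms by (intro compactin_Union) (auto intro!: image_compactin continuous_map_component_injection simp: compact_space_def)
  moreover have "(\<Union>i\<in>I. Pair i ` topspace (X i)) = topspace (sum_topology X I)" by auto
  ultimately show ?thesis by (simp add: compact_space_def)
qed


lemma polish_space_sum_topology:
  "countable I \<Longrightarrow> (\<And>i. i \<in> I \<Longrightarrow> polish_space (X i)) \<Longrightarrow> polish_space (sum_topology X I)"
  unfolding polish_space_def
  by (intro conjI completely_metrizable_space_sum_topology separable_space_sum_topology) auto

text \<open>Reduces the metrizability of sums of compacta to the Polish case.\<close>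

lemma metrizable_compactum_iff_polish:
  "metrizable_compactum X \<longleftrightarrow> polish_space X \<and> compact_space X"
proof -
  have "completely_metrizable_space X" if "metrizable_space X" "compact_space X"
    using that Metric_space.compact_space_imp_mcomplete
    unfolding metrizable_space_def completely_metrizable_space_def by blast
  then show ?thesis
    using metrizable_compactum_separable[of X] completely_metrizable_imp_metrizable_space
    by (auto simp: metrizable_compactum_def polish_space_def)
qed

lemma metrizable_compactum_sum_topology:
  assumes "finite I" "\<And>i. i \<in> I \<Longrightarrow> metrizable_compactum (X i)"
  shows "metrizable_compactum (sum_topology X I)"
  unfolding metrizable_compactum_iff_polish
proof
  show "polish_space (sum_topology X I)"
    by (rule polish_space_sum_topology)
      (use assms metrizable_compactum_iff_polish in \<open>auto simp: countable_finite\<close>)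
  show "compact_space (sum_topology X I)"
    by (rule compact_space_sum_topology) (use assms in \<open>auto simp: metrizable_compactum_def\<close>)
qed

section \<open>Sums of compositions\<close>

lemma equivalent_classesI:
  assumes "\<And>X. X \<in> \<C> \<Longrightarrow> \<exists>Y\<in>\<D>. X homeomorphic_space Y"
    and "\<And>Y. Y \<in> \<D> \<Longrightarrow> \<exists>X\<in>\<C>. X homeomorphic_space Y"
  shows "equivalent_classes \<C> \<D>"
  unfolding equivalent_classes_def
proof (intro conjI ballI)
  fix Y assume "Y \<in> \<D>"
  then obtain X where "X \<in> \<C>" "X homeomorphic_space Y" using assms(2) by blast
  then show "\<exists>X\<in>\<C>. Y homeomorphic_space X" by (auto simp: homeomorphic_space_sym[of Y])
qed (use assms(1) in blast)

lemma equivalent_classes_trans: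
  assumes "equivalent_classes \<C> \<D>" "equivalent_classes \<D> \<E>"
  shows "equivalent_classes \<C> \<E>"
proof (rule equivalent_classesI)
  fix X assume "X \<in> \<C>"
  then obtain Y where Y: "Y \<in> \<D>" "X homeomorphic_space Y"
    using assms(1) unfolding equivalent_classes_def by blast
  then obtain Z where "Z \<in> \<E>" "Y homeomorphic_space Z"
    using assms(2) unfolding equivalent_classes_def by blast
  then show "\<exists>Z\<in>\<E>. X homeomorphic_space Z" using Y homeomorphic_space_trans by blast
next
  fix Z assume "Z \<in> \<E>"
  then obtain Y where Y: "Y \<in> \<D>" "Z homeomorphic_space Y"
    using assms(2) unfolding equivalent_classes_def by blast
  then obtain X where "X \<in> \<C>" "Y homeomorphic_space X"
    using assms(1) unfolding equivalent_classes_def by blast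
  then show "\<exists>X\<in>\<C>. X homeomorphic_space Z"
    using Y homeomorphic_space_trans homeomorphic_space_sym by blast
qed

lemma equivalent_classes_UN:
  assumes "\<And>i. i \<in> I \<Longrightarrow> equivalent_classes (\<C> i) (\<D> i)"
  shows "equivalent_classes (\<Union>i\<in>I. \<C> i) (\<Union>i\<in>I. \<D> i)"
  unfolding equivalent_classes_def
proof (intro conjI ballI)
  fix X assume "X \<in> (\<Union>i\<in>I. \<C> i)"
  then obtain i where i: "i \<in> I" "X \<in> \<C> i" by blast
  then obtain Y where "Y \<in> \<D> i" "X homeomorphic_space Y"
    using assms[OF i(1)] unfolding equivalent_classes_def by blast
  with i(1) show "\<exists>Y\<in>\<Union>i\<in>I. \<D> i. X homeomorphic_space Y" by blast
next
  fix Y assume "Y \<in> (\<Union>i\<in>I. \<D> i)"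
  then obtain i where i: "i \<in> I" "Y \<in> \<D> i" by blast
  then obtain X where "X \<in> \<C> i" "Y homeomorphic_space X"
    using assms[OF i(1)] unfolding equivalent_classes_def by blast
  with i(1) show "\<exists>X\<in>\<Union>i\<in>I. \<C> i. Y homeomorphic_space X" by blast
qed

lemma embedding_map_homeomorphic_subtopology:
  assumes "embedding_map X Y f" "S \<subseteq> topspace X"
  shows "subtopology X S homeomorphic_space subtopology Y (f ` S)"
proof -
  have h: "homeomorphic_map X (subtopology Y (f ` topspace X)) f"
    using assms(1) by (simp add: embedding_map_def)
  have "homeomorphic_map (subtopology X S) (subtopology (subtopology Y (f ` topspace X)) (f ` S)) f"
    using assms(2)
    by (intro homeomorphic_map_subtopologies[OF h])
      (unfold homeomorphic_imp_surjective_map[OF h, symmetric], auto)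
  moreover have "f ` topspace X \<inter> f ` S = f ` S" using assms(2) by blast
  ultimately have "homeomorphic_map (subtopology X S) (subtopology Y (f ` S)) f"
    by (simp add: subtopology_subtopology)
  then show ?thesis by (rule homeomorphic_map_imp_homeomorphic_space)
qed

lemma fibres_sum_topology:
  "equivalent_classes (fibres (sum_topology A I) (sum_topology B I) (\<lambda>(i, a). (i, q i a)))
     (\<Union>i\<in>I. fibres (A i) (B i) (q i))"
proof -
  define fib where "fib i b = {a \<in> topspace (A i). q i a = b}" for i b
  have hom: "subtopology (A i) (fib i b) homeomorphic_space subtopology (sum_topology A I)
      {p \<in> topspace (sum_topology A I). (case p of (j, a) \<Rightarrow> (j, q j a)) = (i, b)}"
    if "i \<in> I" for i b
  proof -
    have "{p \<in> topspace (sum_topology A I). (case p of (j, a) \<Rightarrow> (j, q j a)) = (i, b)} = Pair i ` fib i b"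
      using that by (auto simp: fib_def)
    then show ?thesis
      using embedding_map_homeomorphic_subtopology[OF embedding_map_component_injection[OF that, of A], of "fib i b"]
      by (auto simp: fib_def)
  qed
  have mem: "X \<in> fibres (A i) (B i) (q i) \<longleftrightarrow> (\<exists>b\<in>topspace (B i). X = subtopology (A i) (fib i b))" for X i
    by (auto simp: fibres_def fib_def)
  show ?thesis
  proof (rule equivalent_classesI)
    fix X assume "X \<in> fibres (sum_topology A I) (sum_topology B I) (\<lambda>(i, a). (i, q i a))"
    then obtain i b where ib: "i \<in> I" "b \<in> topspace (B i)"
      and X: "X = subtopology (sum_topology A I)
        {p \<in> topspace (sum_topology A I). (case p of (j, a) \<Rightarrow> (j, q j a)) = (i, b)}"
      by (auto simp: fibres_def)
    have "X homeomorphic_space subtopology (A i) (fib i b)"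
      unfolding X using hom[OF ib(1)] by (subst homeomorphic_space_sym)
    then show "\<exists>Y\<in>\<Union>i\<in>I. fibres (A i) (B i) (q i). X homeomorphic_space Y"
      using ib mem by blast
  next
    fix Y assume "Y \<in> (\<Union>i\<in>I. fibres (A i) (B i) (q i))"
    then obtain i b where ib: "i \<in> I" "b \<in> topspace (B i)" "Y = subtopology (A i) (fib i b)"
      using mem by blast
    let ?X = "subtopology (sum_topology A I)
        {p \<in> topspace (sum_topology A I). (case p of (j, a) \<Rightarrow> (j, q j a)) = (i, b)}"
    have "(i, b) \<in> topspace (sum_topology B I)" using ib by auto
    then have "?X \<in> fibres (sum_topology A I) (sum_topology B I) (\<lambda>(i, a). (i, q i a))"
      unfolding fibres_def by (rule imageI)
    moreover have "?X homeomorphic_space Y"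
      unfolding ib(3) using hom[OF ib(1)] by (subst homeomorphic_space_sym)
    ultimately show "\<exists>X\<in>fibres (sum_topology A I) (sum_topology B I) (\<lambda>(i, a). (i, q i a)). X homeomorphic_space Y"
      by blast
  qed
qed

lemma continuous_map_sum_topology:
  assumes "\<And>i. i \<in> I \<Longrightarrow> continuous_map (A i) (B i) (q i)"
  shows "continuous_map (sum_topology A I) (sum_topology B I) (\<lambda>(i, a). (i, q i a))"
proof -
  have "openin (A i) {a. (i, a) \<in> topspace (sum_topology A I) \<and> (i, q i a) \<in> U}"
    if "i \<in> I" "openin (sum_topology B I) U" for i U
  proof -
    have "{a. (i, a) \<in> topspace (sum_topology A I) \<and> (i, q i a) \<in> U}
        = {a \<in> topspace (A i). q i a \<in> {y. (i, y) \<in> U}}" using that by auto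
    moreover have "openin (A i) {a \<in> topspace (A i). q i a \<in> {y. (i, y) \<in> U}}"
      using that by (intro openin_continuous_map_preimage[OF assms]) (auto simp: openin_sum_topology)
    ultimately show ?thesis by (simp only:)
  qed
  moreover have "q i a \<in> topspace (B i)" if "i \<in> I" "a \<in> topspace (A i)" for i a
    using continuous_map_image_subset_topspace[OF assms[OF that(1)]] that by auto
  ultimately show ?thesis
    by (auto simp: continuous_map_def openin_sum_topology[of A])
qed

text \<open>The points missed by the sum of the maps are the disjoint union of the points missed by
  the summands. The bound \<open>1\<close> therefore survives only if at most one summand fails to be onto;
  \<open>k\<close> is the index of that summand.\<close>

lemma strong_map_sum_topology:
  assumes strong: "\<And>i. i \<in> I \<Longrightarrow> strong_map (A i) (B i) (q i)"
    and onto: "\<And>i. i \<in> I \<Longrightarrow> i \<noteq> k \<Longrightarrow> q i ` topspace (A i) = topspace (B i)"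
  shows "strong_map (sum_topology A I) (sum_topology B I) (\<lambda>(i, a). (i, q i a))"
proof -
  have image: "(\<lambda>(i, a). (i, q i a)) ` Sigma I T = (SIGMA i:I. q i ` T i)" for T
    by force
  have "closed_map (sum_topology A I) (sum_topology B I) (\<lambda>(i, a). (i, q i a))"
    unfolding closed_map_def closedin_sum_topology_alt[of A]
    using strong by (auto simp: image closedin_disjoint_union strong_map_def closed_map_def)
  moreover have "open_map (sum_topology A I) (sum_topology B I) (\<lambda>(i, a). (i, q i a))"
    unfolding open_map_def openin_sum_topology_alt[of A]
    using strong by (auto simp: image openin_disjoint_union strong_map_def open_map_def)
  moreover have "finite S \<and> card S \<le> 1"
    if "S = topspace (sum_topology B I) - (\<lambda>(i, a). (i, q i a)) ` topspace (sum_topology A I)" for S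
  proof (cases "k \<in> I")
    case True
    have "(i, b) \<in> S \<longleftrightarrow> i = k \<and> b \<in> topspace (B k) - q k ` topspace (A k)" for i b
      unfolding that topspace_sum_topology image using onto[of i] True by (cases "i = k") auto
    then have "S = Pair k ` (topspace (B k) - q k ` topspace (A k))" by auto
    then show ?thesis
      using strong[OF True] card_image_le[of "topspace (B k) - q k ` topspace (A k)" "Pair k"]
      by (auto simp: strong_map_def)
  next
    case False
    then have "(i, b) \<notin> S" for i b
      unfolding that topspace_sum_topology image using onto[of i] by (cases "i = k") auto
    then have "S = {}" by auto
    then show ?thesis by simp
  qed
  ultimately show ?thesis unfolding strong_map_def by blast
qed

text \<open>The two strong notions differ only in the property \<open>P\<close> required of the two spaces.\<close>

definition strong_composition :: "(real topology \<Rightarrow> bool) \<Rightarrow> 'a topology set \<Rightarrow> bool" where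
  "strong_composition P \<C> \<longleftrightarrow> (\<exists>(A :: real topology) (B :: real topology) q.
     P A \<and> P B \<and> continuous_map A B q \<and> strong_map A B q \<and> equivalent_classes (fibres A B q) \<C>)"

lemma homeomorphic_space_empty_iff:
  "X homeomorphic_space Y \<Longrightarrow> topspace X = {} \<longleftrightarrow> topspace Y = {}"
  by (simp add: homeomorphic_empty_space)

lemma fibre_over_missing_point:
  assumes "equivalent_classes (fibres A B q) \<C>" "b \<in> topspace B - q ` topspace A"
  shows "\<exists>X\<in>\<C>. topspace X = {}"
proof -
  let ?F = "subtopology A {a \<in> topspace A. q a = b}"
  have "?F \<in> fibres A B q"
    using assms(2) by (auto simp: fibres_def)
  then obtain X where "X \<in> \<C>" "?F homeomorphic_space X"
    using assms(1) unfolding equivalent_classes_def by blast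
  moreover have "topspace ?F = {}" using assms(2) by auto
  ultimately show ?thesis using homeomorphic_space_empty_iff[of ?F X] by blast
qed

text \<open>The image of a closed and open map is clopen, so the target can be cut down to it. This
  removes the empty fibre and nothing else.\<close>

lemma strong_composition_nonempty_part:
  assumes clopen: "\<And>X S. P X \<Longrightarrow> closedin X S \<Longrightarrow> openin X S \<Longrightarrow> P (subtopology X S)"
    and "strong_composition P \<C>"
  shows "strong_composition P {X \<in> \<C>. topspace X \<noteq> {}}"
proof -
  obtain A B q where AB: "P A" "P B" and q: "continuous_map A B q" and s: "strong_map A B q"
    and eq: "equivalent_classes (fibres A B q) \<C>"
    using assms(2) unfolding strong_composition_def by blast
  define R where "R = q ` topspace A"
  have R: "closedin B R" "openin B R" "R \<subseteq> topspace B"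
    using s closedin_subset unfolding R_def strong_map_def closed_map_def open_map_def by blast+
  have P: "P (subtopology B R)" using clopen AB R by blast
  have c: "continuous_map A (subtopology B R) q"
    using q by (auto simp: continuous_map_in_subtopology R_def)
  have "closed_map A (subtopology B R) q"
    unfolding closed_map_def
  proof (intro allI impI)
    fix U assume U: "closedin A U"
    then have "q ` U \<subseteq> R" using closedin_subset unfolding R_def by blast
    then show "closedin (subtopology B R) (q ` U)"
      using s U closedin_subset_topspace unfolding strong_map_def closed_map_def by blast
  qed
  moreover have "open_map A (subtopology B R) q"
    unfolding open_map_def
  proof (intro allI impI)
    fix U assume U: "openin A U"
    then have "q ` U = q ` U \<inter> R" using openin_subset unfolding R_def by blast
    then show "openin (subtopology B R) (q ` U)"
      using s U unfolding strong_map_def open_map_def openin_subtopology by blast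
  qed
  moreover have "topspace (subtopology B R) - q ` topspace A = {}"
    using R by (auto simp: R_def)
  ultimately have st: "strong_map A (subtopology B R) q"
    unfolding strong_map_def by (simp only: finite.emptyI card.empty zero_le simp_thms)
  define F where "F b = subtopology A {a \<in> topspace A. q a = b}" for b
  have F: "topspace (F b) \<noteq> {} \<longleftrightarrow> b \<in> R" for b
    unfolding F_def topspace_subtopology R_def by blast
  have fib: "fibres A B q = F ` topspace B" "fibres A (subtopology B R) q = F ` R"
    using R(3) by (simp_all add: fibres_def F_def inf.absorb2)
  have mem: "X \<in> fibres A (subtopology B R) q \<longleftrightarrow> X \<in> fibres A B q \<and> topspace X \<noteq> {}" for X
  proof
    assume "X \<in> fibres A (subtopology B R) q"
    then obtain b where "b \<in> R" "X = F b" using fib(2) by blast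
    then show "X \<in> fibres A B q \<and> topspace X \<noteq> {}" using F R(3) fib(1) by blast
  next
    assume X: "X \<in> fibres A B q \<and> topspace X \<noteq> {}"
    then obtain b where "X = F b" using fib(1) by blast
    then show "X \<in> fibres A (subtopology B R) q" using F X fib(2) by blast
  qed
  have "equivalent_classes (fibres A (subtopology B R) q) {X \<in> \<C>. topspace X \<noteq> {}}"
    unfolding equivalent_classes_def
  proof (intro conjI ballI)
    fix X assume X: "X \<in> fibres A (subtopology B R) q"
    then obtain Y where "Y \<in> \<C>" "X homeomorphic_space Y"
      using eq mem unfolding equivalent_classes_def by blast
    with X show "\<exists>Y\<in>{X \<in> \<C>. topspace X \<noteq> {}}. X homeomorphic_space Y"
      using homeomorphic_space_empty_iff[of X Y] mem by blast
  next
    fix Y assume Y: "Y \<in> {X \<in> \<C>. topspace X \<noteq> {}}"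
    then obtain X where "X \<in> fibres A B q" "Y homeomorphic_space X"
      using eq unfolding equivalent_classes_def by blast
    with Y show "\<exists>X\<in>fibres A (subtopology B R) q. Y homeomorphic_space X"
      using homeomorphic_space_empty_iff[of Y X] mem by blast
  qed
  then show ?thesis unfolding strong_composition_def using AB P c st by blast
qed

section \<open>Embedding metrizable compacta in a normed space\<close>

text \<open>The Kuratowski embedding into bounded sequences: a point is sent to its distances from the
  members of a countable dense set. The distance is capped at \<open>1\<close>, so that images can be shrunk
  uniformly by scaling.\<close>

lemma metrizable_compactum_embedding:
  assumes "metrizable_compactum X"
  obtains e :: "'a \<Rightarrow> (nat \<Rightarrow>\<^sub>C real)"
  where "continuous_map X euclidean e" "inj_on e (topspace X)" "\<And>x. norm (e x) \<le> 1"
proof -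
  obtain M d where M: "Metric_space M d" and X: "X = Metric_space.mtopology M d"
    using assms unfolding metrizable_compactum_def metrizable_space_def by blast
  define c where "c = Metric_space.capped_dist d 1"
  interpret Metric_space M c
    unfolding c_def using Metric_space.capped_dist[OF M] .
  have X: "X = mtopology" unfolding c_def X using Metric_space.mtopology_capped_metric[OF M] by simp
  have c1: "c x y \<le> 1" for x y
    by (simp add: c_def Metric_space.capped_dist_def[OF M])
  obtain D where D: "countable D" "D \<subseteq> M" "mtopology closure_of D = M"
    using metrizable_compactum_separable[OF assms] unfolding separable_space_def X topspace_mtopology by blast
  define z where "z = from_nat_into D"
  define e where "e x = Bcontfun (\<lambda>i. c x (z i))" for x
  have bc: "(\<lambda>i. c x (z i)) \<in> bcontfun" for x
    unfolding bcontfun_def using c1 by (auto simp: bounded_iff intro!: exI[of _ 1])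
  have e: "apply_bcontfun (e x) i = c x (z i)" for x i
    by (simp add: e_def Bcontfun_inverse[OF bc])
  have zM: "z i \<in> M" if "M \<noteq> {}" for i
  proof -
    have "D \<noteq> {}" using that D(3) by auto
    then show ?thesis using from_nat_into[of D i] D(2) by (auto simp: z_def)
  qed
  have dist: "dist (e x) (e y) \<le> c x y" if "x \<in> M" "y \<in> M" for x y
  proof (rule dist_bound)
    fix i
    have zi: "z i \<in> M" using zM that by auto
    show "dist (apply_bcontfun (e x) i) (apply_bcontfun (e y) i) \<le> c x y"
      using mdist_reverse_triangle[of x "z i" y] that zi commute[of y "z i"]
      by (simp add: e dist_real_def)
  qed
  show thesis
  proof
    show "continuous_map X euclidean e"
      unfolding continuous_map_def
    proof (intro conjI allI impI)
      fix U :: "(nat \<Rightarrow>\<^sub>C real) set" assume U: "openin euclidean U"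
      show "openin X {x \<in> topspace X. e x \<in> U}"
        unfolding X openin_mtopology topspace_mtopology
      proof (intro conjI allI impI)
        fix x assume x: "x \<in> {x \<in> M. e x \<in> U}"
        then obtain r where r: "r > 0" "ball (e x) r \<subseteq> U"
          using U open_contains_ball by (metis (no_types, lifting) mem_Collect_eq open_openin)
        have "mball x r \<subseteq> {x \<in> M. e x \<in> U}"
          using dist r(2) by (force simp: subset_iff)
        then show "\<exists>r>0. mball x r \<subseteq> {x \<in> M. e x \<in> U}" using r by blast
      qed auto
    qed auto
    show "inj_on e (topspace X)"
    proof (rule inj_onI, rule ccontr)
      fix x y assume xy: "x \<in> topspace X" "y \<in> topspace X" "e x = e y" "x \<noteq> y"
      then have M: "x \<in> M" "y \<in> M" by (auto simp: X)
      then have pos: "c x y / 2 > 0" using xy by simp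
      have "x \<in> mtopology closure_of D" using D M by simp
      then obtain w where w: "w \<in> D" "w \<in> mball x (c x y / 2)"
        using pos unfolding metric_closure_of by blast
      then obtain i where i: "z i = w"
        unfolding z_def using D(1) from_nat_into_surj by metis
      have "c x w = c y w" using e[of x i] e[of y i] xy i by simp
      moreover have "c x y \<le> c x w + c w y" using triangle w M by auto
      moreover have "c x w < c x y / 2" using w by auto
      ultimately show False using commute[of y w] by linarith
    qed
    show "norm (e x) \<le> 1" for x
      by (rule norm_bound) (use c1 in \<open>auto simp: e\<close>)
  qed
qed

text \<open>Compacta that converge to a compactum \<open>Z\<close> form a compactum together with it: finitely many
  open sets that cover \<open>Z\<close> already cover all but finitely many of them.\<close>

lemma compact_null_union:
  fixes Z :: "'b::metric_space set"
  assumes Z: "compact Z" and K: "\<And>m. m \<in> M \<Longrightarrow> compact (K m)"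
    and small: "\<And>\<delta>. \<delta> > 0 \<Longrightarrow> finite {m \<in> M. \<not> K m \<subseteq> (\<Union>z\<in>Z. ball z \<delta>)}"
  shows "compact (Z \<union> (\<Union>m\<in>M. K m))"
  unfolding compact_eq_Heine_Borel
proof (intro allI impI)
  fix \<T> assume T: "(\<forall>T\<in>\<T>. open T) \<and> Z \<union> (\<Union>m\<in>M. K m) \<subseteq> \<Union>\<T>"
  obtain \<D> where D: "\<D> \<subseteq> \<T>" "finite \<D>" "Z \<subseteq> \<Union>\<D>"
    using Z T unfolding compact_eq_Heine_Borel by (metis le_sup_iff)
  then have "open (\<Union>\<D>)" using T by blast
  then obtain \<delta> where \<delta>: "\<delta> > 0" "(\<Union>z\<in>Z. ball z \<delta>) \<subseteq> \<Union>\<D>"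
    using compact_subset_open_imp_ball_epsilon_subset[OF Z _ D(3)] by blast
  define N where "N = {m \<in> M. \<not> K m \<subseteq> (\<Union>z\<in>Z. ball z \<delta>)}"
  have "compact (\<Union>m\<in>N. K m)"
    using small[OF \<delta>(1)] K by (intro compact_UN) (auto simp: N_def)
  moreover have "(\<Union>m\<in>N. K m) \<subseteq> \<Union>\<T>" using T by (auto simp: N_def)
  ultimately obtain \<E> where E: "\<E> \<subseteq> \<T>" "finite \<E>" "(\<Union>m\<in>N. K m) \<subseteq> \<Union>\<E>"
    using T unfolding compact_eq_Heine_Borel by metis
  have "Z \<union> (\<Union>m\<in>M. K m) \<subseteq> \<Union>(\<D> \<union> \<E>)"
  proof
    fix x assume "x \<in> Z \<union> (\<Union>m\<in>M. K m)"
    then consider "x \<in> Z" | m where "m \<in> M" "x \<in> K m" by blast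
    then show "x \<in> \<Union>(\<D> \<union> \<E>)"
    proof cases
      case 2
      show ?thesis
      proof (cases "m \<in> N")
        case True
        then show ?thesis using 2 E(3) by blast
      next
        case False
        then have "K m \<subseteq> (\<Union>z\<in>Z. ball z \<delta>)" using 2 by (simp add: N_def)
        then show ?thesis using 2 \<delta>(2) by blast
      qed
    qed (use D in auto)
  qed
  then show "\<exists>\<T>'\<subseteq>\<T>. finite \<T>' \<and> Z \<union> (\<Union>m\<in>M. K m) \<subseteq> \<Union>\<T>'"
    using D E by (intro exI[of _ "\<D> \<union> \<E>"]) auto
qed

section \<open>Null sequences of families\<close>

lemma finite_large_weights:
  assumes M: "countable M" and "\<delta> > 0"
  shows "finite {m \<in> M. \<delta> \<le> 1 / (real (to_nat_on M m) + 1)}"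
proof -
  let ?L = "{m \<in> M. \<delta> \<le> 1 / (real (to_nat_on M m) + 1)}"
  have "to_nat_on M ` ?L \<subseteq> {.. nat \<lceil>1 / \<delta>\<rceil>}"
  proof clarsimp
    fix m assume "\<delta> \<le> 1 / (real (to_nat_on M m) + 1)"
    then have "real (to_nat_on M m) + 1 \<le> 1 / \<delta>"
      using \<open>\<delta> > 0\<close> by (simp add: field_simps)
    then show "to_nat_on M m \<le> nat \<lceil>1 / \<delta>\<rceil>" by linarith
  qed
  moreover have "inj_on (to_nat_on M) ?L"
    using inj_on_to_nat_on[OF M] by (rule inj_on_subset) auto
  ultimately show ?thesis using finite_imageD finite_subset by blast
qed

text \<open>Put a scaled copy of \<open>A m\<close> over a scaled copy of \<open>B m\<close> for each \<open>m\<close>, with scaling factors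
  tending to \<open>0\<close>, and translate the copy of \<open>A m\<close> along \<open>f m\<close>. The bases shrink to one point and
  the total spaces accumulate only at \<open>F\<close>, which becomes the fibre over that point. If moreover
  every fibre of \<open>q m\<close> comes \<open>\<epsilon> m\<close>-close to every point of \<open>F\<close>, then the map is open at the points
  of \<open>F\<close> as well.\<close>

lemma null_sequence_of_families:
  fixes A :: "'m \<Rightarrow> 'x topology" and B :: "'m \<Rightarrow> 'y topology"
    and f :: "'m \<Rightarrow> 'x \<Rightarrow> 'e::real_normed_vector"
  assumes M: "countable M"
    and A: "\<And>m. m \<in> M \<Longrightarrow> metrizable_compactum (A m)"
    and B: "\<And>m. m \<in> M \<Longrightarrow> metrizable_compactum (B m)"
    and q: "\<And>m. m \<in> M \<Longrightarrow> continuous_map (A m) (B m) (q m)"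
    and f: "\<And>m. m \<in> M \<Longrightarrow> continuous_map (A m) euclidean (f m)"
    and F: "compact F" "F \<noteq> {}" "X0 homeomorphic_space top_of_set F"
    and near: "\<And>m a. m \<in> M \<Longrightarrow> a \<in> topspace (A m) \<Longrightarrow> \<exists>x\<in>F. dist (f m a) x < \<epsilon> m"
    and \<epsilon>: "\<And>\<delta>. \<delta> > 0 \<Longrightarrow> finite {m \<in> M. \<delta> \<le> \<epsilon> m}"
  shows "compactifiable (insert X0 (\<Union>m\<in>M. fibres (A m) (B m) (q m)))"
    and "\<lbrakk>\<And>m. m \<in> M \<Longrightarrow> open_map (A m) (B m) (q m);
      \<And>m b x. \<lbrakk>m \<in> M; b \<in> topspace (B m); x \<in> F\<rbrakk>
        \<Longrightarrow> \<exists>a\<in>topspace (A m). q m a = b \<and> dist (f m a) x < \<epsilon> m\<rbrakk>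
      \<Longrightarrow> strongly_compactifiable (insert X0 (\<Union>m\<in>M. fibres (A m) (B m) (q m)))"
proof -
  have "\<exists>e :: 'x \<Rightarrow> (nat \<Rightarrow>\<^sub>C real). continuous_map (A m) euclidean e \<and> inj_on e (topspace (A m)) \<and> (\<forall>x. norm (e x) \<le> 1)"
    if "m \<in> M" for m
    using metrizable_compactum_embedding[OF A[OF that]] by metis
  then obtain eA :: "'m \<Rightarrow> 'x \<Rightarrow> (nat \<Rightarrow>\<^sub>C real)" where eA: "\<And>m. m \<in> M \<Longrightarrow> continuous_map (A m) euclidean (eA m)"
    "\<And>m. m \<in> M \<Longrightarrow> inj_on (eA m) (topspace (A m))" "\<And>m x. m \<in> M \<Longrightarrow> norm (eA m x) \<le> 1"
    by metis
  have "\<exists>e :: 'y \<Rightarrow> (nat \<Rightarrow>\<^sub>C real). continuous_map (B m) euclidean e \<and> inj_on e (topspace (B m)) \<and> (\<forall>x. norm (e x) \<le> 1)"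
    if "m \<in> M" for m
    using metrizable_compactum_embedding[OF B[OF that]] by metis
  then obtain eB :: "'m \<Rightarrow> 'y \<Rightarrow> (nat \<Rightarrow>\<^sub>C real)" where eB: "\<And>m. m \<in> M \<Longrightarrow> continuous_map (B m) euclidean (eB m)"
    "\<And>m. m \<in> M \<Longrightarrow> inj_on (eB m) (topspace (B m))" "\<And>m x. m \<in> M \<Longrightarrow> norm (eB m x) \<le> 1"
    by metis
  \<comment> \<open>Distinct positive scaling factors keep the copies disjoint from each other and from the limit.\<close>
  define s where "s m = 1 / (real (to_nat_on M m) + 1)" for m
  have s0: "s m > 0" for m by (simp add: s_def add_pos_nonneg)
  have s_inj: "s m = s n \<longleftrightarrow> m = n" if "m \<in> M" "n \<in> M" for m n
    using M that by (auto simp: s_def divide_simps)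
  have s_small: "finite {m \<in> M. \<delta> \<le> s m}" if "\<delta> > 0" for \<delta>
    unfolding s_def using finite_large_weights[OF M that] .
  define \<beta> where "\<beta> m b = (s m, s m *\<^sub>R eB m b)" for m b
  \<comment> \<open>The first component makes the projection \<open>fst\<close> the required map, the second one carries the
  approximation of \<open>F\<close>, and the last one makes \<open>\<alpha> m\<close> injective.\<close>
  define \<alpha> where "\<alpha> m a = (\<beta> m (q m a), (f m a, s m *\<^sub>R eA m a))" for m a
  define z :: "real \<times> (nat \<Rightarrow>\<^sub>C real)" where "z = 0"
  define F0 :: "((real \<times> (nat \<Rightarrow>\<^sub>C real)) \<times> ('e \<times> (nat \<Rightarrow>\<^sub>C real))) set"
    where "F0 = {z} \<times> (F \<times> {0})"
  define SB where "SB = {z} \<union> (\<Union>m\<in>M. \<beta> m ` topspace (B m))"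
  define SA where "SA = F0 \<union> (\<Union>m\<in>M. \<alpha> m ` topspace (A m))"
  have q_in: "q m a \<in> topspace (B m)" if "m \<in> M" "a \<in> topspace (A m)" for m a
    using continuous_map_image_subset_topspace[OF q[OF that(1)]] that by blast
  have \<beta>_cont: "continuous_map (B m) euclidean (\<beta> m)" if "m \<in> M" for m
  proof -
    have "continuous_map euclidean euclidean (\<lambda>x::nat \<Rightarrow>\<^sub>C real. (s m, s m *\<^sub>R x))"
      by (simp add: continuous_intros)
    from continuous_map_compose[OF eB(1)[OF that] this] show ?thesis
      by (simp add: comp_def \<beta>_def[abs_def])
  qed
  have \<alpha>_cont: "continuous_map (A m) euclidean (\<alpha> m)" if "m \<in> M" for m
  proof -
    have "continuous_map (A m) euclidean (\<lambda>a. (\<beta> m (q m a), (f m a, eA m a)))"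
      using continuous_map_compose[OF q[OF that] \<beta>_cont[OF that]] f[OF that] eA(1)[OF that]
      unfolding prod_topology_euclidean[symmetric] by (intro continuous_map_pairedI) (simp_all add: comp_def)
    from this have "continuous_map (A m) euclidean
        ((\<lambda>p. (fst p, (fst (snd p), s m *\<^sub>R snd (snd p)))) \<circ> (\<lambda>a. (\<beta> m (q m a), (f m a, eA m a))))"
      by (rule continuous_map_compose) (simp add: continuous_intros)
    then show ?thesis by (simp add: comp_def \<alpha>_def[abs_def])
  qed
  have \<beta>_inj: "\<beta> m b = \<beta> n c \<longleftrightarrow> m = n \<and> b = c"
    if "m \<in> M" "n \<in> M" "b \<in> topspace (B m)" "c \<in> topspace (B n)" for m n b c
    using that s_inj[of m n] s0[of m] inj_onD[OF eB(2)[OF that(1)]] by (auto simp: \<beta>_def)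
  have \<beta>_z: "\<beta> m b \<noteq> z" for m b
    using s0[of m] by (auto simp: \<beta>_def z_def zero_prod_def)
  have \<alpha>_inj: "inj_on (\<alpha> m) (topspace (A m))" if "m \<in> M" for m
    using that s0[of m] eA(2) by (auto simp: \<alpha>_def inj_on_def)
  have \<alpha>_emb: "embedding_map (A m) euclidean (\<alpha> m)" if "m \<in> M" for m
    using continuous_imp_embedding_map[OF \<alpha>_cont[OF that] _ _ \<alpha>_inj[OF that]] A[OF that]
    by (simp add: metrizable_compactum_def)
  have \<beta>_dist: "dist z (\<beta> m b) \<le> 2 * s m" if "m \<in> M" for m b
  proof -
    have "norm (\<beta> m b) \<le> norm (s m) + norm (s m *\<^sub>R eB m b)"
      unfolding \<beta>_def by (rule norm_Pair_le)
    also have "\<dots> \<le> 2 * s m"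
      using mult_left_le[OF eB(3)[OF that, of b], of "s m"] s0[of m] by (simp add: less_imp_le)
    finally show ?thesis by (simp add: z_def)
  qed
  have \<alpha>_dist: "dist (z, (x, 0)) (\<alpha> m a) < \<delta>"
    if "m \<in> M" "dist (f m a) x < \<epsilon> m" "s m < \<delta> / 6" "\<epsilon> m < \<delta> / 6" for m a x \<delta>
  proof -
    have "dist (z, (x, 0)) (\<alpha> m a) \<le> dist z (\<beta> m (q m a)) + dist (x, 0) (f m a, s m *\<^sub>R eA m a)"
      unfolding \<alpha>_def dist_Pair_Pair by (rule sqrt_sum_squares_le_sum) auto
    also have "\<dots> \<le> 2 * s m + (dist x (f m a) + dist 0 (s m *\<^sub>R eA m a))"
      unfolding dist_Pair_Pair[of x] by (intro add_mono \<beta>_dist that sqrt_sum_squares_le_sum) auto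
    also have "dist 0 (s m *\<^sub>R eA m a) \<le> s m"
      using mult_left_le[OF eA(3)[OF that(1), of a], of "s m"] s0[of m] by (simp add: less_imp_le)
    finally show ?thesis using that s0[of m] by (simp add: dist_commute)
  qed
  have few: "finite {m \<in> M. \<not> (s m < \<delta> \<and> \<epsilon> m < \<delta>)}" if "\<delta> > 0" for \<delta>
  proof (rule finite_subset)
    show "{m \<in> M. \<not> (s m < \<delta> \<and> \<epsilon> m < \<delta>)} \<subseteq> {m \<in> M. \<delta> \<le> s m} \<union> {m \<in> M. \<delta> \<le> \<epsilon> m}" by auto
    show "finite ({m \<in> M. \<delta> \<le> s m} \<union> {m \<in> M. \<delta> \<le> \<epsilon> m})" using s_small \<epsilon> that by simp
  qed
  have imgB: "compact (\<beta> m ` T)" if "m \<in> M" "closedin (B m) T" for m T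
    using image_compactin[OF closedin_compact_space[OF _ that(2)] \<beta>_cont[OF that(1)]] B[OF that(1)]
    by (simp add: metrizable_compactum_def)
  have \<beta>_few: "finite {m \<in> M. \<not> \<beta> m ` T m \<subseteq> (\<Union>y\<in>{z}. ball y \<delta>)}" if "\<delta> > 0" for \<delta> T
  proof (rule finite_subset[OF _ s_small])
    show "{m \<in> M. \<not> \<beta> m ` T m \<subseteq> (\<Union>y\<in>{z}. ball y \<delta>)} \<subseteq> {m \<in> M. \<delta> / 3 \<le> s m}"
    proof clarsimp
      fix m b assume "m \<in> M" "b \<in> T m" "\<not> dist z (\<beta> m b) < \<delta>"
      then show "\<delta> \<le> s m * 3" using \<beta>_dist[of m b] s0[of m] by linarith
    qed
  qed (use that in simp)
  have compB: "compact SB"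
    unfolding SB_def using \<beta>_few by (intro compact_null_union imgB) auto
  have compA: "compact SA"
    unfolding SA_def
  proof (rule compact_null_union)
    show "compact F0" unfolding F0_def using F by (intro compact_Times) auto
    show "compact (\<alpha> m ` topspace (A m))" if "m \<in> M" for m
      using image_compactin[OF _ \<alpha>_cont[OF that]] A[OF that]
      by (auto simp: metrizable_compactum_def compact_space_def)
    show "finite {m \<in> M. \<not> \<alpha> m ` topspace (A m) \<subseteq> (\<Union>y\<in>F0. ball y \<delta>)}" if "\<delta> > 0" for \<delta>
    proof (rule finite_subset[OF _ few])
      have "\<alpha> m a \<in> (\<Union>y\<in>F0. ball y \<delta>)"
        if m: "m \<in> M" "s m < \<delta> / 6" "\<epsilon> m < \<delta> / 6" and a: "a \<in> topspace (A m)" for m a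
      proof -
        obtain x where x: "x \<in> F" "dist (f m a) x < \<epsilon> m" using near m a by blast
        then show ?thesis
          using \<alpha>_dist[OF m(1) x(2) m(2,3)] by (intro UN_I[of "(z, (x, 0))"]) (auto simp: F0_def)
      qed
      then show "{m \<in> M. \<not> \<alpha> m ` topspace (A m) \<subseteq> (\<Union>y\<in>F0. ball y \<delta>)}
          \<subseteq> {m \<in> M. \<not> (s m < \<delta> / 6 \<and> \<epsilon> m < \<delta> / 6)}" by blast
    qed (use that in simp)
  qed
  define A' where "A' = top_of_set SA"
  define B' where "B' = top_of_set SB"
  have mcA: "metrizable_compactum A'" and mcB: "metrizable_compactum B'"
    using compA compB by (auto simp: metrizable_compactum_def A'_def B'_def
        metrizable_space_subtopology metrizable_space_euclidean compact_space_subtopology)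
  have fst_\<alpha>: "fst (\<alpha> m a) = \<beta> m (q m a)" for m a by (simp add: \<alpha>_def)
  have fst_sub: "fst ` SA \<subseteq> SB"
    using q_in unfolding SA_def SB_def F0_def by (auto simp: fst_\<alpha>)
  have cont: "continuous_map A' B' fst"
    using fst_sub unfolding A'_def B'_def by (auto intro!: continuous_intros)
  have SA_piece: "\<exists>n\<in>M. \<exists>a\<in>topspace (A n). p = \<alpha> n a" if "p \<in> SA" "fst p \<noteq> z" for p
    using that by (auto simp: SA_def F0_def)
  have SA_limit: "p \<in> F0" if "p \<in> SA" "fst p = z" for p
  proof (rule ccontr)
    assume "p \<notin> F0"
    with that(1) obtain n a where "p = \<alpha> n a" unfolding SA_def by blast
    then show False using that(2) fst_\<alpha>[of n a] \<beta>_z[of n "q n a"] by simp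
  qed
  define fib where "fib b = subtopology A' {p \<in> topspace A'. fst p = b}" for b
  define fibm where "fibm m b = subtopology (A m) {a \<in> topspace (A m). q m a = b}" for m b
  have fib_z: "fib z homeomorphic_space X0"
  proof -
    have "fib z = top_of_set F0"
      unfolding fib_def A'_def subtopology_subtopology
    proof (rule arg_cong[of _ _ "subtopology euclidean"])
      have "fst p = z" "p \<in> SA" if "p \<in> F0" for p
        using that by (auto simp: F0_def SA_def)
      then show "SA \<inter> {p \<in> topspace (top_of_set SA). fst p = z} = F0"
        using SA_limit by auto
    qed
    moreover have "top_of_set F homeomorphic_space top_of_set F0"
      unfolding homeomorphic_space_def homeomorphic_maps_def F0_def
      by (rule exI[of _ "\<lambda>x. (z, (x, 0))"], rule exI[of _ "fst \<circ> snd"])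
        (auto intro!: continuous_intros)
    ultimately have "X0 homeomorphic_space fib z" using F(3) homeomorphic_space_trans by metis
    then show ?thesis by (subst homeomorphic_space_sym)
  qed
  have fib_\<beta>: "fib (\<beta> m b) homeomorphic_space fibm m b" if "m \<in> M" "b \<in> topspace (B m)" for m b
  proof -
    have "SA \<inter> {p \<in> SA. fst p = \<beta> m b} = \<alpha> m ` {a \<in> topspace (A m). q m a = b}"
      (is "?l = ?r")
    proof (intro subset_antisym subsetI)
      fix p assume "p \<in> ?l"
      then have p: "p \<in> SA" "fst p = \<beta> m b" by auto
      then obtain n a where n: "n \<in> M" "a \<in> topspace (A n)" "p = \<alpha> n a"
        using SA_piece \<beta>_z by metis
      have "\<beta> n (q n a) = \<beta> m b" using p(2) n(3) by (simp add: fst_\<alpha>)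
      then have "n = m \<and> q n a = b" using \<beta>_inj[OF n(1) that(1) q_in[OF n(1,2)] that(2)] by blast
      then show "p \<in> ?r" using n by auto
    next
      fix p assume "p \<in> ?r"
      then show "p \<in> ?l" using that by (auto simp: SA_def fst_\<alpha>)
    qed
    then have "fib (\<beta> m b) = top_of_set (\<alpha> m ` {a \<in> topspace (A m). q m a = b})"
      unfolding fib_def A'_def subtopology_subtopology by simp
    moreover have "fibm m b homeomorphic_space top_of_set (\<alpha> m ` {a \<in> topspace (A m). q m a = b})"
      unfolding fibm_def by (rule embedding_map_homeomorphic_subtopology[OF \<alpha>_emb[OF that(1)]]) auto
    ultimately show ?thesis by (subst homeomorphic_space_sym) (simp only:)
  qed
  have eq: "equivalent_classes (fibres A' B' fst) (insert X0 (\<Union>m\<in>M. fibres (A m) (B m) (q m)))"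
  proof (rule equivalent_classesI)
    fix X assume "X \<in> fibres A' B' fst"
    then obtain p where "p \<in> SB" "X = fib p" by (auto simp: fibres_def fib_def B'_def)
    then consider "X = fib z" | m b where "m \<in> M" "b \<in> topspace (B m)" "X = fib (\<beta> m b)"
      by (auto simp: SB_def)
    then show "\<exists>Y\<in>insert X0 (\<Union>m\<in>M. fibres (A m) (B m) (q m)). X homeomorphic_space Y"
    proof cases
      case 2
      then have "fibm m b \<in> fibres (A m) (B m) (q m)" by (auto simp: fibres_def fibm_def)
      with 2 fib_\<beta>[OF 2(1,2)] show ?thesis by blast
    qed (use fib_z in blast)
  next
    fix Y assume "Y \<in> insert X0 (\<Union>m\<in>M. fibres (A m) (B m) (q m))"
    then consider "Y = X0" | m b where "m \<in> M" "b \<in> topspace (B m)" "Y = fibm m b"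
      by (auto simp: fibres_def fibm_def)
    then obtain p where "p \<in> SB" "fib p homeomorphic_space Y"
    proof cases
      case 1
      then show ?thesis using fib_z that[of z] by (auto simp: SB_def)
    next
      case 2
      then show ?thesis using fib_\<beta> that[of "\<beta> m b"] by (auto simp: SB_def)
    qed
    then show "\<exists>X\<in>fibres A' B' fst. X homeomorphic_space Y"
      by (auto simp: fibres_def fib_def B'_def)
  qed
  show "compactifiable (insert X0 (\<Union>m\<in>M. fibres (A m) (B m) (q m)))"
    by (rule compactifiableI[OF mcA mcB cont eq])
  show "strongly_compactifiable (insert X0 (\<Union>m\<in>M. fibres (A m) (B m) (q m)))"
    if op: "\<And>m. m \<in> M \<Longrightarrow> open_map (A m) (B m) (q m)"
      and dense: "\<And>m b x. \<lbrakk>m \<in> M; b \<in> topspace (B m); x \<in> F\<rbrakk>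
        \<Longrightarrow> \<exists>a\<in>topspace (A m). q m a = b \<and> dist (f m a) x < \<epsilon> m"
  proof -
    have onto: "topspace B' - fst ` topspace A' = {}"
    proof -
      obtain x0 where x0: "x0 \<in> F" using F by blast
      have "z \<in> fst ` SA" using x0 by (force simp: SA_def F0_def)
      moreover have "\<beta> m b \<in> fst ` SA" if m: "m \<in> M" "b \<in> topspace (B m)" for m b
      proof -
        obtain a where "a \<in> topspace (A m)" "q m a = b" using dense[OF m x0] by blast
        then have "\<alpha> m a \<in> SA" "fst (\<alpha> m a) = \<beta> m b" using m by (auto simp: SA_def fst_\<alpha>)
        then show ?thesis by force
      qed
      ultimately show ?thesis by (auto simp: A'_def B'_def SB_def)
    qed
    have "closed_map A' B' fst"
      using continuous_imp_closed_map[OF cont] mcA mcB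
      by (simp add: metrizable_compactum_def metrizable_imp_Hausdorff_space)
    moreover have "open_map A' B' fst"
      unfolding open_map_def
    proof (intro allI impI)
      fix U assume "openin A' U"
      then obtain V where V: "open V" "U = SA \<inter> V" by (auto simp: A'_def openin_open)
      \<comment> \<open>Openness is shown by proving the complement of the image compact. It consists of the compact
  sets \<open>\<beta> m ` W m\<close> and possibly \<open>z\<close>. If \<open>z\<close> is missing from it, then all but finitely many \<open>W m\<close>
  are empty by density.\<close>
      define W where "W m = topspace (B m) - q m ` {a \<in> topspace (A m). \<alpha> m a \<in> V}" for m
      define Z where "Z = {z} - fst ` U"
      have W: "closedin (B m) (W m)" if "m \<in> M" for m
      proof -
        have "openin (A m) {a \<in> topspace (A m). \<alpha> m a \<in> V}"
          using openin_continuous_map_preimage[OF \<alpha>_cont[OF that]] V by simp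
        then show ?thesis unfolding W_def using op[OF that] by (auto simp: open_map_def)
      qed
      have "compact (Z \<union> (\<Union>m\<in>M. \<beta> m ` W m))"
      proof (rule compact_null_union)
        show "compact Z" unfolding Z_def by (intro finite_imp_compact) simp
        show "compact (\<beta> m ` W m)" if "m \<in> M" for m using imgB W that by blast
        fix \<delta> :: real assume \<delta>: "\<delta> > 0"
        show "finite {m \<in> M. \<not> \<beta> m ` W m \<subseteq> (\<Union>y\<in>Z. ball y \<delta>)}"
        proof (cases "z \<in> fst ` U")
          case False
          then have "Z = {z}" unfolding Z_def by blast
          then show ?thesis using \<beta>_few[OF \<delta>] by simp
        next
          case True
          then obtain p where p: "p \<in> SA" "p \<in> V" "fst p = z" using V by auto
          then obtain x where x: "x \<in> F" "p = (z, (x, 0))"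
            using SA_limit[OF p(1,3)] by (auto simp: F0_def)
          obtain \<rho> where \<rho>: "\<rho> > 0" "ball p \<rho> \<subseteq> V" using V(1) p(2) open_contains_ball by blast
          show ?thesis
          proof (rule finite_subset[OF _ few])
            have "W m = {}" if m: "m \<in> M" "s m < \<rho> / 6" "\<epsilon> m < \<rho> / 6" for m
            proof -
              have "b \<in> q m ` {a \<in> topspace (A m). \<alpha> m a \<in> V}" if b: "b \<in> topspace (B m)" for b
              proof -
                obtain a where a: "a \<in> topspace (A m)" "q m a = b" "dist (f m a) x < \<epsilon> m"
                  using dense[OF m(1) b x(1)] by blast
                have "\<alpha> m a \<in> V" using \<alpha>_dist[OF m(1) a(3) m(2,3)] \<rho>(2) x(2) by auto
                then show ?thesis using a by blast
              qed
              then show ?thesis by (auto simp: W_def)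
            qed
            then show "{m \<in> M. \<not> \<beta> m ` W m \<subseteq> (\<Union>y\<in>Z. ball y \<delta>)}
                \<subseteq> {m \<in> M. \<not> (s m < \<rho> / 6 \<and> \<epsilon> m < \<rho> / 6)}" by blast
          qed (use \<rho> in simp)
        qed
      qed
      then have closed: "closed (Z \<union> (\<Union>m\<in>M. \<beta> m ` W m))" by (rule compact_imp_closed)
      have in_image: "\<beta> m b \<in> fst ` U \<longleftrightarrow> b \<in> q m ` {a \<in> topspace (A m). \<alpha> m a \<in> V}"
        if m: "m \<in> M" "b \<in> topspace (B m)" for m b
      proof
        assume "\<beta> m b \<in> fst ` U"
        then obtain p where p: "p \<in> SA" "p \<in> V" "fst p = \<beta> m b" using V by auto
        then obtain n a where n: "n \<in> M" "a \<in> topspace (A n)" "p = \<alpha> n a"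
          using SA_piece \<beta>_z by metis
        have "\<beta> n (q n a) = \<beta> m b" using p(3) n(3) by (simp add: fst_\<alpha>)
        then have "n = m \<and> q n a = b" using \<beta>_inj[OF n(1) m(1) q_in[OF n(1,2)] m(2)] by blast
        then show "b \<in> q m ` {a \<in> topspace (A m). \<alpha> m a \<in> V}" using n p by auto
      next
        assume "b \<in> q m ` {a \<in> topspace (A m). \<alpha> m a \<in> V}"
        then obtain a where a: "a \<in> topspace (A m)" "\<alpha> m a \<in> V" "q m a = b" by blast
        then have "\<alpha> m a \<in> U" using m V by (auto simp: SA_def)
        then show "\<beta> m b \<in> fst ` U" using a(3) fst_\<alpha>[of m a] by force
      qed
      have "SB - (Z \<union> (\<Union>m\<in>M. \<beta> m ` W m)) = fst ` U"
      proof (intro subset_antisym subsetI)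
        fix p assume p: "p \<in> SB - (Z \<union> (\<Union>m\<in>M. \<beta> m ` W m))"
        then consider "p = z" | m b where "m \<in> M" "b \<in> topspace (B m)" "p = \<beta> m b" by (auto simp: SB_def)
        then show "p \<in> fst ` U"
        proof cases
          case 1 then show ?thesis using p by (auto simp: Z_def)
        next
          case 2
          then have "b \<notin> W m" using p by blast
          then show ?thesis using 2 in_image by (auto simp: W_def)
        qed
      next
        fix p assume p: "p \<in> fst ` U"
        then have "p \<in> SB" using fst_sub V by blast
        moreover have "p \<notin> Z" using p by (auto simp: Z_def)
        moreover have "p \<notin> \<beta> m ` W m" if "m \<in> M" for m
        proof
          assume "p \<in> \<beta> m ` W m"
          then obtain b where "p = \<beta> m b" "b \<in> W m" by blast
          then show False using p in_image[OF that, of b] by (auto simp: W_def)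
        qed
        ultimately show "p \<in> SB - (Z \<union> (\<Union>m\<in>M. \<beta> m ` W m))" by blast
      qed
      then have "fst ` U = SB \<inter> - (Z \<union> (\<Union>m\<in>M. \<beta> m ` W m))" by blast
      then show "openin B' (fst ` U)"
        unfolding B'_def openin_open using open_Compl[OF closed] by blast
    qed
    ultimately have "strong_map A' B' fst" unfolding strong_map_def onto by simp
    then show ?thesis by (rule strongly_compactifiableI[OF mcA mcB cont _ eq])
  qed
qed

section \<open>Approximating a compactum by images of another one\<close>

lemma finite_net:
  fixes S :: "'b::metric_space set"
  assumes "compact S" "\<epsilon> > 0"
  obtains N where "finite N" "N \<subseteq> S" "S \<subseteq> (\<Union>x\<in>N. ball x \<epsilon>)"
proof -
  have "seq_compact S" using assms(1) by (simp add: compact_eq_seq_compact_metric)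
  from seq_compact_imp_totally_bounded[OF this] assms(2) that show thesis by metis
qed

text \<open>The \<open>\<epsilon>\<close>-neighbourhood of a connected set is open and connected, hence path connected in a
  normed space, so one path inside it visits all points of a finite \<open>\<epsilon>\<close>-net.\<close>

lemma connected_approximated_by_path:
  fixes C :: "'e::real_normed_vector set"
  assumes C: "connected C" "C \<noteq> {}" "compact C" and "\<epsilon> > 0"
  obtains \<gamma> :: "real \<Rightarrow> 'e" where "continuous_on {0..1} \<gamma>"
    "\<forall>t\<in>{0..1}. \<exists>y\<in>C. dist (\<gamma> t) y < \<epsilon>"
    "\<forall>y\<in>C. \<exists>t\<in>{0..1}. dist (\<gamma> t) y < \<epsilon>"
proof -
  define U where "U = (\<Union>x\<in>C. ball x \<epsilon>)"
  have CU: "C \<subseteq> U" using \<open>\<epsilon> > 0\<close> by (auto simp: U_def)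
  have "open U" by (auto simp: U_def)
  moreover have "connected (C \<union> \<Union>((\<lambda>x. ball x \<epsilon>) ` C))"
    using C(1) \<open>\<epsilon> > 0\<close> by (intro connected_Un_UN) auto
  then have "connected U" using CU by (simp add: U_def Un_absorb1)
  ultimately have pc: "path_connected U" by (rule connected_open_path_connected)
  have net: "\<exists>g. path g \<and> path_image g \<subseteq> U \<and> N \<subseteq> path_image g" if "finite N" "N \<noteq> {}" "N \<subseteq> C" for N
    using that
  proof (induction N rule: finite_ne_induct)
    case (singleton x)
    then show ?case
      using CU by (intro exI[of _ "\<lambda>_. x"]) (auto simp: path_def path_image_def)
  next
    case (insert x N)
    then obtain g where g: "path g" "path_image g \<subseteq> U" "N \<subseteq> path_image g" by auto
    have "pathfinish g \<in> U" "x \<in> U" using g CU insert by auto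
    then obtain h where h: "path h" "path_image h \<subseteq> U" "pathstart h = pathfinish g" "pathfinish h = x"
      using pc unfolding path_connected_def by metis
    show ?case
    proof (intro exI conjI)
      show "path (g +++ h)" using g h by simp
      show "path_image (g +++ h) \<subseteq> U" "insert x N \<subseteq> path_image (g +++ h)"
        using g h by (auto simp: path_image_join)
    qed
  qed
  obtain N where N: "finite N" "N \<subseteq> C" "C \<subseteq> (\<Union>x\<in>N. ball x \<epsilon>)"
    by (rule finite_net[OF C(3) \<open>\<epsilon> > 0\<close>])
  then have "N \<noteq> {}" using C by auto
  then obtain g where g: "path g" "path_image g \<subseteq> U" "N \<subseteq> path_image g" using net[OF N(1) \<open>N \<noteq> {}\<close> N(2)] by auto
  show thesis
  proof
    show "continuous_on {0..1} g" using g by (simp add: path_def)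
    show "\<forall>t\<in>{0..1}. \<exists>y\<in>C. dist (g t) y < \<epsilon>"
      using g(2) by (fastforce simp: path_image_def U_def dist_commute)
    show "\<forall>y\<in>C. \<exists>t\<in>{0..1}. dist (g t) y < \<epsilon>"
    proof
      fix y assume "y \<in> C"
      obtain x where x: "x \<in> N" "dist x y < \<epsilon>" using N(3) \<open>y \<in> C\<close> by auto
      then obtain t where "t \<in> {0..1}" "g t = x" using g(3) by (auto simp: path_image_def)
      then show "\<exists>t\<in>{0..1}. dist (g t) y < \<epsilon>" using x by auto
    qed
  qed
qed

text \<open>A partition of \<open>K\<close> into \<open>n\<close> nonempty clopen pieces, numbered by a locally constant map.\<close>

definition splits :: "'e::topological_space set \<Rightarrow> nat \<Rightarrow> ('e \<Rightarrow> nat) \<Rightarrow> bool" where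
  "splits K n g \<longleftrightarrow> continuous_on K g \<and> g ` K = {..<n}"

text \<open>The compactum has exactly \<open>c\<close> components, of which exactly \<open>j\<close> have more than one point; those
  are numbered first. The pairs \<open>(c, j)\<close> are compared componentwise below.\<close>

definition component_type :: "'e::topological_space set \<Rightarrow> nat \<Rightarrow> nat \<Rightarrow> bool" where
  "component_type K c j \<longleftrightarrow> j \<le> c \<and> (\<exists>g. splits K c g \<and>
     (\<forall>i<c. connected {x \<in> K. g x = i}) \<and>
     (\<forall>i<c. i < j \<longleftrightarrow> (\<exists>a\<in>K. \<exists>b\<in>K. g a = i \<and> g b = i \<and> a \<noteq> b)))"

text \<open>Some continuous image of \<open>K\<close> is at Hausdorff distance less than \<open>\<epsilon>\<close> from \<open>F\<close>. The image is
  required to factor through the plane, because two real functions on a fibre extend to the whole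
  space by Tietze's theorem, whereas a map into an infinite-dimensional space would need a stronger
  extension theorem.\<close>

definition approximable :: "'e::real_normed_vector set \<Rightarrow> 'e set \<Rightarrow> real \<Rightarrow> bool" where
  "approximable K F \<epsilon> \<longleftrightarrow> (\<exists>(g :: 'e \<Rightarrow> real) (u :: 'e \<Rightarrow> real) (\<phi> :: real \<times> real \<Rightarrow> 'e).
     continuous_on K g \<and> continuous_on K u \<and> continuous_on UNIV \<phi> \<and>
     (\<forall>x\<in>K. \<exists>y\<in>F. dist (\<phi> (g x, u x)) y < \<epsilon>) \<and>
     (\<forall>y\<in>F. \<exists>x\<in>K. dist (\<phi> (g x, u x)) y < \<epsilon>))"

text \<open>It suffices to map each clopen piece of \<open>K\<close> along a path of its own.\<close>

lemma approximableI:
  fixes \<gamma> :: "nat \<Rightarrow> real \<Rightarrow> 'e::real_normed_vector"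
  assumes g: "splits K n g" and u: "continuous_on K u" "u ` K \<subseteq> {0..1}"
    and \<gamma>: "\<And>i. i < n \<Longrightarrow> continuous_on {0..1} (\<gamma> i)"
    and near: "\<And>x. x \<in> K \<Longrightarrow> \<exists>y\<in>F. dist (\<gamma> (g x) (u x)) y < \<epsilon>"
    and dense: "\<And>y. y \<in> F \<Longrightarrow> \<exists>x\<in>K. dist (\<gamma> (g x) (u x)) y < \<epsilon>"
  shows "approximable K F \<epsilon>"
proof -
  define clamp where "clamp t = max 0 (min 1 t)" for t :: real
  \<comment> \<open>The tent functions make the \<open>i\<close>-th summand the only one that is nonzero on the line of
  points with first coordinate \<open>i\<close>.\<close>
  define \<phi> where "\<phi> p = (\<Sum>i<n. max 0 (1 - \<bar>fst p - real i\<bar>) *\<^sub>R \<gamma> i (clamp (snd p)))" for p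
  have "continuous_on UNIV (\<lambda>p::real \<times> real. \<gamma> i (clamp (snd p)))" if "i < n" for i
  proof (rule continuous_on_compose2[OF \<gamma>[OF that]])
    show "continuous_on UNIV (\<lambda>p::real \<times> real. clamp (snd p))"
      unfolding clamp_def by (intro continuous_intros)
  qed (auto simp: clamp_def)
  then have "continuous_on UNIV \<phi>"
    unfolding \<phi>_def by (intro continuous_intros) auto
  moreover have "\<phi> (real (g x), u x) = \<gamma> (g x) (u x)" if "x \<in> K" for x
  proof -
    have gx: "g x < n" using g that by (auto simp: splits_def)
    have "clamp (u x) = u x" using u(2) that by (auto simp: clamp_def)
    have "\<phi> (real (g x), u x) = (\<Sum>i<n. if i = g x then \<gamma> (g x) (u x) else 0)"
      unfolding \<phi>_def
    proof (rule sum.cong[OF refl])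
      fix i
      have "max 0 (1 - \<bar>real (g x) - real i\<bar>) = (if i = g x then 1 else 0)"
        by (auto simp: max_def)
      then show "max 0 (1 - \<bar>fst (real (g x), u x) - real i\<bar>) *\<^sub>R \<gamma> i (clamp (snd (real (g x), u x)))
          = (if i = g x then \<gamma> (g x) (u x) else 0)"
        using \<open>clamp (u x) = u x\<close> by auto
    qed
    also have "\<dots> = \<gamma> (g x) (u x)" using gx by simp
    finally show ?thesis .
  qed
  moreover have "continuous_on K (\<lambda>x. real (g x))"
    using continuous_on_of_nat[of K g] g by (simp add: splits_def)
  ultimately show ?thesis
    unfolding approximable_def using u(1) near dense
    by (intro exI[of _ "\<lambda>x. real (g x)"] exI[of _ u] exI[of _ \<phi>]) simp
qed

lemma continuous_on_discrete_compose:
  fixes g :: "'a::topological_space \<Rightarrow> 'd::discrete_topology" and w :: "'d \<Rightarrow> 'z::topological_space"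
  assumes "continuous_on K g"
  shows "continuous_on K (\<lambda>x. w (g x))"
  unfolding continuous_on_open_invariant
proof (intro allI impI)
  fix B :: "'z set"
  have "open (w -` B)" by (rule open_discrete)
  then obtain A where "open A" "A \<inter> K = g -` (w -` B) \<inter> K"
    using continuous_on_open_invariant[THEN iffD1, OF assms] by metis
  moreover have "(\<lambda>x. w (g x)) -` B = g -` (w -` B)" by auto
  ultimately show "\<exists>A. open A \<and> A \<inter> K = (\<lambda>x. w (g x)) -` B \<inter> K"
    by metis
qed

lemma splits_compose:
  assumes "splits K n g" "h ` {..<n} = {..<m}"
  shows "splits K m (h \<circ> g)"
  unfolding splits_def
proof
  show "continuous_on K (h \<circ> g)"
    unfolding comp_def using assms(1) by (simp add: splits_def continuous_on_discrete_compose)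
  have "(h \<circ> g) ` K = h ` (g ` K)" by (rule image_comp[symmetric])
  also have "\<dots> = h ` {..<n}" using assms(1) by (simp add: splits_def)
  finally show "(h \<circ> g) ` K = {..<m}" using assms(2) by simp
qed

text \<open>A compactum with infinitely many components approximates everything: map its pieces to the
  points of a finite net.\<close>

lemma approximable_if_many_pieces:
  assumes F: "compact F" "F \<noteq> {}" and many: "\<And>n. n \<ge> 1 \<Longrightarrow> \<exists>g. splits K n g" and "\<epsilon> > 0"
  shows "approximable K F \<epsilon>"
proof -
  obtain N where N: "finite N" "N \<subseteq> F" "F \<subseteq> (\<Union>x\<in>N. ball x \<epsilon>)"
    by (rule finite_net[OF F(1) \<open>\<epsilon> > 0\<close>])
  then have "N \<noteq> {}" using F by auto
  then have "card N \<ge> 1" using N by (simp add: Suc_leI card_gt_0_iff)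
  then obtain g where g: "splits K (card N) g" using many by blast
  obtain p where p: "bij_betw p {..<card N} N"
    using ex_bij_betw_nat_finite[OF N(1)] by (auto simp: lessThan_atLeast0)
  show ?thesis
  proof (rule approximableI[OF g, of "\<lambda>_. 0" "\<lambda>i _. p i"])
    fix x assume "x \<in> K"
    then have "p (g x) \<in> F" using g p N(2) by (auto simp: splits_def bij_betw_def)
    then show "\<exists>y\<in>F. dist (p (g x)) y < \<epsilon>" using \<open>\<epsilon> > 0\<close> by (intro bexI[of _ "p (g x)"]) auto
  next
    fix y assume "y \<in> F"
    then obtain w where w: "w \<in> N" "dist w y < \<epsilon>" using N by auto
    then obtain i where "i < card N" "p i = w"
      using p unfolding bij_betw_def by (metis imageE lessThan_iff)
    then obtain x where "x \<in> K" "g x = i" using g unfolding splits_def by (metis imageE lessThan_iff)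
    then show "\<exists>x\<in>K. dist (p (g x)) y < \<epsilon>" using w \<open>p i = w\<close> by auto
  qed auto
qed

text \<open>If the number of clopen pieces is bounded, the pieces of a largest partition are connected,
  because splitting one of them would give a larger partition.\<close>

lemma component_type_exists:
  fixes K :: "'e::metric_space set"
  assumes K: "K \<noteq> {}" and few: "\<not> (\<forall>n\<ge>1. \<exists>g. splits K n g)"
  shows "\<exists>c j. component_type K c j"
proof -
  define S where "S n \<longleftrightarrow> (\<exists>g. splits K n g)" for n
  have "S 1" unfolding S_def splits_def
    using K by (intro exI[of _ "\<lambda>_. 0"]) (auto simp: lessThan_Suc)
  have "\<exists>c\<ge>1. S c \<and> \<not> S (Suc c)"
  proof (rule ccontr)
    assume "\<not> ?thesis"
    then have step: "S (Suc c)" if "c \<ge> 1" "S c" for c using that by blast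
    have "S n" if "n \<ge> 1" for n
      using that by (induction n rule: nat_induct_at_least) (use \<open>S 1\<close> step in auto)
    then show False using few by (simp add: S_def)
  qed
  then obtain c g where g: "splits K c g" and c: "\<not> S (Suc c)" by (auto simp: S_def)
  have conn: "connected {x \<in> K. g x = i}" if "i < c" for i
  proof (rule ccontr)
    let ?K = "{x \<in> K. g x = i}"
    assume "\<not> connected ?K"
    then obtain P Q where PQ: "open P" "open Q" "P \<inter> Q \<inter> ?K = {}" "?K \<subseteq> P \<union> Q" "P \<inter> ?K \<noteq> {}" "Q \<inter> ?K \<noteq> {}"
      unfolding connected_def by auto
    \<comment> \<open>Detach the part of the piece \<open>i\<close> that lies in \<open>Q\<close> and give it the new number \<open>c\<close>.\<close>
    define g' where "g' x = (if g x = i \<and> x \<in> Q then c else g x)" for x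
    have "continuous_on K g'"
      unfolding continuous_on_open_invariant
    proof (intro allI impI)
      fix B :: "nat set"
      have "\<exists>T. open T \<and> T \<inter> K = g -` {k} \<inter> K" for k
        using g unfolding splits_def continuous_on_open_invariant by (metis open_discrete)
      then obtain T where T: "\<And>k. open (T k)" "\<And>k. T k \<inter> K = g -` {k} \<inter> K" by metis
      let ?V = "(\<Union>k\<in>B - {c} - {i}. T k) \<union> (if i \<in> B then T i \<inter> P else {}) \<union> (if c \<in> B then T i \<inter> Q else {})"
      have memT: "x \<in> T k \<longleftrightarrow> g x = k" if "x \<in> K" for x k using T(2)[of k] that by auto
      have gc: "g x \<noteq> c" if "x \<in> K" for x using g that by (auto simp: splits_def)
      have "open ?V" using T(1) PQ by auto
      moreover have "x \<in> ?V \<longleftrightarrow> g' x \<in> B" if "x \<in> K" for x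
        using PQ(3,4) that gc[OF that] \<open>i < c\<close> by (auto simp: memT g'_def)
      ultimately show "\<exists>A. open A \<and> A \<inter> K = g' -` B \<inter> K"
        by (intro exI[of _ ?V]) blast
    qed
    moreover have "g' ` K = {..<Suc c}"
    proof (intro subset_antisym subsetI)
      fix k assume "k \<in> g' ` K"
      then show "k \<in> {..<Suc c}" using g by (auto simp: g'_def splits_def less_Suc_eq)
    next
      fix k assume k: "k \<in> {..<Suc c}"
      consider "k = c" | "k = i" | "k < c" "k \<noteq> i" using k by fastforce
      then show "k \<in> g' ` K"
      proof cases
        case 1 then show ?thesis using PQ(6) by (force simp: g'_def)
      next
        case 2
        obtain x where "x \<in> P" "x \<in> ?K" using PQ(5) by blast
        then have "g' x = i" "x \<in> K" using PQ(3) by (auto simp: g'_def)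
        then show ?thesis using 2 by blast
      next
        case 3
        then obtain x where "x \<in> K" "g x = k" using g unfolding splits_def by (metis imageE lessThan_iff)
        then show ?thesis using 3 by (force simp: g'_def)
      qed
    qed
    ultimately show False using c by (auto simp: S_def splits_def)
  qed
  define D where "D = {i. i < c \<and> (\<exists>a\<in>K. \<exists>b\<in>K. g a = i \<and> g b = i \<and> a \<noteq> b)}"
  define j where "j = card D"
  have D: "D \<subseteq> {..<c}" "finite D" by (auto simp: D_def)
  then have j: "j \<le> c" unfolding j_def using card_mono[of "{..<c}" D] by simp
  \<comment> \<open>Renumber the pieces so that the nondegenerate ones come first.\<close>
  obtain p1 where p1: "bij_betw p1 D {..<j}"
    using finite_same_card_bij[OF D(2) finite_lessThan, of j] unfolding j_def card_lessThan by blast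
  have "card ({..<c} - D) = card {j..<c}"
    using D by (simp add: j_def card_Diff_subset)
  then obtain p2 where p2: "bij_betw p2 ({..<c} - D) {j..<c}"
    using finite_same_card_bij[of "{..<c} - D" "{j..<c}"] by blast
  define p where "p i = (if i \<in> D then p1 i else p2 i)" for i
  have pD: "p i < j \<longleftrightarrow> i \<in> D" "p i < c" if "i < c" for i
  proof -
    have "p i < j \<and> i \<in> D \<or> p i \<in> {j..<c} \<and> i \<notin> D"
    proof (cases "i \<in> D")
      case True
      then show ?thesis using bij_betwE[OF p1] by (simp add: p_def)
    next
      case False
      then have "p2 i \<in> {j..<c}" using bij_betwE[OF p2] that by blast
      with False show ?thesis by (simp add: p_def)
    qed
    then show "p i < j \<longleftrightarrow> i \<in> D" "p i < c" using j by auto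
  qed
  have "bij_betw p (D \<union> ({..<c} - D)) ({..<j} \<union> {j..<c})"
    unfolding p_def by (rule bij_betw_disjoint_Un[OF p1 p2]) auto
  moreover have "D \<union> ({..<c} - D) = {..<c}" "{..<j} \<union> {j..<c} = {..<c}" using D j by auto
  ultimately have p: "bij_betw p {..<c} {..<c}" by simp
  have piece: "(p \<circ> g) x = p i \<longleftrightarrow> g x = i" if "i < c" "x \<in> K" for i x
    using that g p unfolding bij_betw_def splits_def comp_def
    by (metis imageI inj_on_eq_iff lessThan_iff)
  have "component_type K c j"
    unfolding component_type_def
  proof (intro conjI exI allI impI)
    show "j \<le> c" by (rule j)
    show "splits K c (p \<circ> g)" using splits_compose[OF g] p by (auto simp: bij_betw_def)
    fix k assume "k < c"
    then obtain i where i: "i < c" "k = p i" using p unfolding bij_betw_def by (metis imageE lessThan_iff)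
    have "{x \<in> K. (p \<circ> g) x = k} = {x \<in> K. g x = i}" using piece[OF i(1)] i(2) by blast
    then show "connected {x \<in> K. (p \<circ> g) x = k}" using conn[OF i(1)] by simp
    show "k < j \<longleftrightarrow> (\<exists>a\<in>K. \<exists>b\<in>K. (p \<circ> g) a = k \<and> (p \<circ> g) b = k \<and> a \<noteq> b)"
      using pD[OF i(1)] piece[OF i(1)] i by (simp add: D_def cong: bex_cong)
  qed
  then show ?thesis by blast
qed

lemma component_typeE:
  assumes "component_type K c j"
  obtains g where "splits K c g" "\<forall>i<c. connected {x \<in> K. g x = i}"
    "\<forall>i<c. i < j \<longleftrightarrow> (\<exists>a\<in>K. \<exists>b\<in>K. g a = i \<and> g b = i \<and> a \<noteq> b)"
  using assms unfolding component_type_def by (elim conjE exE) (erule (2) that)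

text \<open>Every component of \<open>F\<close> is matched with a component of \<open>K\<close>, a nondegenerate one with a
  nondegenerate one. A nondegenerate component of \<open>K\<close> maps onto the unit interval by a distance
  function, and the interval maps to a path that follows the matched component of \<open>F\<close>. Components
  of \<open>K\<close> that are left over are sent to a single point of \<open>F\<close>.\<close>

lemma approximable_if_component_type_le:
  fixes K F :: "'e::real_normed_vector set"
  assumes K: "component_type K c j" and F: "component_type F c' j'" "compact F"
    and le: "c' \<le> c" "j' \<le> j" and "\<epsilon> > 0" "F \<noteq> {}"
  shows "approximable K F \<epsilon>"
proof -
  obtain g where g0: "splits K c g" "\<forall>i<c. connected {x \<in> K. g x = i}"
    "\<forall>i<c. i < j \<longleftrightarrow> (\<exists>a\<in>K. \<exists>b\<in>K. g a = i \<and> g b = i \<and> a \<noteq> b)"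
    by (rule component_typeE[OF K])
  note g = g0(1) g0(2)[rule_format] g0(3)[rule_format]
  obtain h where h0: "splits F c' h" "\<forall>i<c'. connected {x \<in> F. h x = i}"
    "\<forall>i<c'. i < j' \<longleftrightarrow> (\<exists>a\<in>F. \<exists>b\<in>F. h a = i \<and> h b = i \<and> a \<noteq> b)"
    by (rule component_typeE[OF F(1)])
  note h = h0(1) h0(2)[rule_format] h0(3)[rule_format]
  have j: "j \<le> c" using K by (simp add: component_type_def)
  have ne: "\<exists>x\<in>K. g x = i" if "i < c" for i
    using g(1) that unfolding splits_def by (metis imageE lessThan_iff)
  have neF: "\<exists>x\<in>F. h x = i" if "i < c'" for i
    using h(1) that unfolding splits_def by (metis imageE lessThan_iff)
  have "\<exists>a b. a \<in> K \<and> b \<in> K \<and> g a = i \<and> g b = i \<and> a \<noteq> b" if "i < j" for i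
    using g(3)[of i] that j by auto
  then obtain a b where ab: "\<And>i. i < j \<Longrightarrow> a i \<in> K \<and> b i \<in> K \<and> g (a i) = i \<and> g (b i) = i \<and> a i \<noteq> b i"
    by metis
  define k where "k i = 1 / dist (b i) (a i)" for i
  \<comment> \<open>On the piece \<open>i < j\<close> this runs from \<open>0\<close> at \<open>a i\<close> to \<open>1\<close> at \<open>b i\<close>. For \<open>i \<ge> j\<close> the points \<open>a i\<close> and
  \<open>b i\<close> are arbitrary.\<close>
  define u where "u x = min 1 (dist x (a (g x)) * k (g x))" for x
  have g_cont: "continuous_on K (\<lambda>x. w (g x))" for w :: "nat \<Rightarrow> 'z::topological_space"
    using g(1) by (simp add: splits_def continuous_on_discrete_compose)
  have "continuous_on K u"
    unfolding u_def by (intro continuous_intros g_cont)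
  have u01: "u ` K \<subseteq> {0..1}" by (auto simp: u_def k_def)
  have u_onto: "\<exists>x\<in>K. g x = i \<and> u x = t" if "i < j" "t \<in> {0..1}" for i t
  proof -
    have "connected (u ` {x \<in> K. g x = i})"
      using g(2)[of i] that j continuous_on_subset[OF \<open>continuous_on K u\<close>]
      by (intro connected_continuous_image) auto
    moreover have "u (a i) = 0" "u (b i) = 1" using ab[OF that(1)] by (auto simp: u_def k_def)
    then have "0 \<in> u ` {x \<in> K. g x = i}" "1 \<in> u ` {x \<in> K. g x = i}"
      using ab[OF that(1)] by (force simp: image_iff)+
    ultimately have "t \<in> u ` {x \<in> K. g x = i}"
      using that(2) connected_contains_Icc by (metis subsetD)
    then show ?thesis by auto
  qed
  obtain y0 where y0: "y0 \<in> F" using \<open>F \<noteq> {}\<close> by blast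
  define G where "G i \<gamma> \<longleftrightarrow> continuous_on {0..1} \<gamma> \<and> (\<forall>t\<in>{0..1}. \<exists>y\<in>F. dist (\<gamma> t) y < \<epsilon>) \<and>
      (i < c' \<longrightarrow> (\<forall>y\<in>F. h y = i \<longrightarrow> (\<exists>x\<in>K. g x = i \<and> dist (\<gamma> (u x)) y < \<epsilon>)))"
    for i and \<gamma> :: "real \<Rightarrow> 'e"
  have "\<exists>\<gamma>. G i \<gamma>" if i: "i < c" for i
  proof -
    consider "i < j'" | "j' \<le> i" "i < c'" | "c' \<le> i" by linarith
    then show "\<exists>\<gamma>. G i \<gamma>"
    proof cases
      case 1
      then have i': "i < c'" "i < j" using F(1) le by (auto simp: component_type_def)
      have compact: "compact {y \<in> F. h y = i}"
      proof -
        have "closedin (top_of_set F) (F \<inter> h -` {i})"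
          using h(1) by (intro continuous_closedin_preimage) (auto simp: splits_def)
        moreover have "F \<inter> h -` {i} = {y \<in> F. h y = i}" by auto
        ultimately show ?thesis using closedin_compact[OF F(2)] by auto
      qed
      have "{y \<in> F. h y = i} \<noteq> {}" using neF[OF i'(1)] by blast
      then obtain \<gamma> :: "real \<Rightarrow> 'e" where \<gamma>0: "continuous_on {0..1} \<gamma>"
        "\<forall>t\<in>{0..1}. \<exists>y\<in>{y \<in> F. h y = i}. dist (\<gamma> t) y < \<epsilon>"
        "\<forall>y\<in>{y \<in> F. h y = i}. \<exists>t\<in>{0..1}. dist (\<gamma> t) y < \<epsilon>"
        by (rule connected_approximated_by_path[OF h(2)[OF i'(1)] _ compact \<open>\<epsilon> > 0\<close>])
      show ?thesis
        unfolding G_def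
      proof (intro exI[of _ \<gamma>] conjI ballI impI)
        show "\<exists>y\<in>F. dist (\<gamma> t) y < \<epsilon>" if "t \<in> {0..1}" for t using \<gamma>0(2) that by blast
        fix y assume "y \<in> F" "h y = i"
        then obtain t where t: "t \<in> {0..1}" "dist (\<gamma> t) y < \<epsilon>" using \<gamma>0(3) by blast
        then show "\<exists>x\<in>K. g x = i \<and> dist (\<gamma> (u x)) y < \<epsilon>" using u_onto[OF i'(2) t(1)] by metis
      qed (rule \<gamma>0)
    next
      case 2
      obtain y where y: "y \<in> F" "h y = i" using neF[OF 2(2)] by blast
      then have y': "w = y" if "w \<in> F" "h w = i" for w
        using h(3)[OF 2(2)] 2(1) that by (metis leD)
      obtain x where "x \<in> K" "g x = i" using ne[OF i] by blast
      show ?thesis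
        unfolding G_def
      proof (intro exI[of _ "\<lambda>_. y"] conjI ballI impI)
        show "\<exists>v\<in>F. dist y v < \<epsilon>" using y(1) \<open>\<epsilon> > 0\<close> by (intro bexI[of _ y]) auto
        show "\<exists>x\<in>K. g x = i \<and> dist y w < \<epsilon>" if "w \<in> F" "h w = i" for w
          using y'[OF that] \<open>x \<in> K\<close> \<open>g x = i\<close> \<open>\<epsilon> > 0\<close> by (intro bexI[of _ x]) auto
      qed simp
    next
      case 3
      have "\<exists>v\<in>F. dist y0 v < \<epsilon>" using y0 \<open>\<epsilon> > 0\<close> by (intro bexI[of _ y0]) auto
      then show ?thesis using 3 by (intro exI[of _ "\<lambda>_. y0"]) (simp add: G_def)
    qed
  qed
  then obtain \<gamma> where \<gamma>: "\<And>i. i < c \<Longrightarrow> G i (\<gamma> i)" by metis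
  show ?thesis
  proof (rule approximableI[OF g(1) \<open>continuous_on K u\<close> u01, of \<gamma>])
    show "\<exists>y\<in>F. dist (\<gamma> (g x) (u x)) y < \<epsilon>" if "x \<in> K" for x
    proof -
      have "g x < c" "u x \<in> {0..1}" using g(1) u01 that by (auto simp: splits_def)
      then show ?thesis using \<gamma> unfolding G_def by blast
    qed
    show "\<exists>x\<in>K. dist (\<gamma> (g x) (u x)) y < \<epsilon>" if y: "y \<in> F" for y
    proof -
      have "h y < c'" using h(1) y by (auto simp: splits_def)
      then have "\<exists>x\<in>K. g x = h y \<and> dist (\<gamma> (h y) (u x)) y < \<epsilon>"
        using \<gamma>[of "h y"] le(1) y unfolding G_def by simp
      then show ?thesis by metis
    qed
  qed (use \<gamma> in \<open>simp add: G_def\<close>)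
qed

text \<open>Dickson's lemma for pairs. Take a pair with least second entry; every pair that is not above
  it has a smaller first entry, and for each of these finitely many first entries the least second
  entry is enough.\<close>

lemma finite_minimal_pairs:
  fixes T :: "(nat \<times> nat) set"
  shows "\<exists>T0\<subseteq>T. finite T0 \<and> (\<forall>(c, j)\<in>T. \<exists>(c', j')\<in>T0. c' \<le> c \<and> j' \<le> j)"
proof (cases "T = {}")
  case False
  define j0 where "j0 = (LEAST j. \<exists>c. (c, j) \<in> T)"
  have "\<exists>j c. (c, j) \<in> T" using False by auto
  then obtain c0 where c0: "(c0, j0) \<in> T" unfolding j0_def using LeastI_ex by (smt (verit))
  have j0: "j0 \<le> j" if "(c, j) \<in> T" for c j unfolding j0_def using that by (auto intro: Least_le)
  define m where "m c = (LEAST j. (c, j) \<in> T)" for c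
  have m: "(c, m c) \<in> T" "m c \<le> j" if "(c, j) \<in> T" for c j
    unfolding m_def using that by (auto intro: LeastI Least_le)
  define T0 where "T0 = insert (c0, j0) ((\<lambda>c. (c, m c)) ` {c. c < c0 \<and> (\<exists>j. (c, j) \<in> T)})"
  show ?thesis
  proof (intro exI[of _ T0] conjI ballI)
    show "T0 \<subseteq> T" using c0 m by (auto simp: T0_def)
    show "finite T0" by (simp add: T0_def)
    fix p assume "p \<in> T"
    then obtain c j where p: "p = (c, j)" "(c, j) \<in> T" by (cases p) auto
    have "\<exists>(c', j')\<in>T0. c' \<le> c \<and> j' \<le> j"
    proof (cases "c < c0")
      case True
      then show ?thesis using p m[OF p(2)] by (intro bexI[of _ "(c, m c)"]) (auto simp: T0_def)
    next
      case False
      then show ?thesis using j0 p by (intro bexI[of _ "(c0, j0)"]) (auto simp: T0_def)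
    qed
    then show "case p of (c, j) \<Rightarrow> \<exists>(c', j')\<in>T0. c' \<le> c \<and> j' \<le> j" using p by simp
  qed
qed auto

text \<open>The members with finitely many components are handled by representatives of the minimal
  component types, the others approximate any member at all.\<close>

lemma finitely_many_limits:
  fixes \<K> :: "'e::real_normed_vector set set"
  assumes \<K>: "\<And>K. K \<in> \<K> \<Longrightarrow> compact K \<and> K \<noteq> {}"
  shows "\<exists>\<J>\<subseteq>\<K>. finite \<J> \<and> (\<forall>K\<in>\<K>. \<exists>F\<in>\<J>. \<forall>\<epsilon>>0. approximable K F \<epsilon>)"
proof (cases "\<K> = {}")
  case False
  then obtain F0 where F0: "F0 \<in> \<K>" by blast
  define T where "T = {(c, j). \<exists>K\<in>\<K>. component_type K c j}"
  obtain T0 where T0: "T0 \<subseteq> T" "finite T0" "\<forall>(c, j)\<in>T. \<exists>(c', j')\<in>T0. c' \<le> c \<and> j' \<le> j"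
    using finite_minimal_pairs[of T] by blast
  have "\<forall>p\<in>T0. \<exists>K\<in>\<K>. component_type K (fst p) (snd p)" using T0(1) by (auto simp: T_def)
  then obtain r where r: "\<And>p. p \<in> T0 \<Longrightarrow> r p \<in> \<K> \<and> component_type (r p) (fst p) (snd p)" by metis
  define \<J> where "\<J> = insert F0 (r ` T0)"
  show ?thesis
  proof (intro exI[of _ \<J>] conjI ballI)
    show "\<J> \<subseteq> \<K>" "finite \<J>" using F0 r T0(2) by (auto simp: \<J>_def)
    fix K assume K: "K \<in> \<K>"
    show "\<exists>F\<in>\<J>. \<forall>\<epsilon>>0. approximable K F \<epsilon>"
    proof (cases "\<forall>n\<ge>1. \<exists>g. splits K n g")
      case True
      then show ?thesis
        using approximable_if_many_pieces[of F0 K] \<K>[OF F0] by (intro bexI[of _ F0]) (auto simp: \<J>_def)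
    next
      case False
      then obtain c j where cj: "component_type K c j" using component_type_exists \<K>[OF K] by blast
      then have "(c, j) \<in> T" using K by (auto simp: T_def)
      then obtain c' j' where le: "(c', j') \<in> T0" "c' \<le> c" "j' \<le> j" using T0(3) by blast
      then show ?thesis
        using approximable_if_component_type_le[OF cj, of "r (c', j')" c' j'] r[OF le(1)] \<K>
        by (intro bexI[of _ "r (c', j')"]) (auto simp: \<J>_def)
    qed
  qed
qed auto

section \<open>Sums of classes\<close>

lemma strongly_compactifiable_iff: "strongly_compactifiable \<C> \<longleftrightarrow> strong_composition metrizable_compactum \<C>"
  unfolding strongly_compactifiable_def strong_composition_def ..

lemma strongly_Polishable_iff: "strongly_Polishable \<C> \<longleftrightarrow> strong_composition polish_space \<C>"
  unfolding strongly_Polishable_def strong_composition_def ..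

text \<open>At most one of the classes may contain an empty space, since each such class can
  contribute a point that is missed by the map.\<close>

lemma strong_composition_sum:
  assumes comp: "\<And>i. i \<in> I \<Longrightarrow> strong_composition P (\<D> i)"
    and nonempty: "\<And>i X. i \<in> I \<Longrightarrow> i \<noteq> k \<Longrightarrow> X \<in> \<D> i \<Longrightarrow> topspace X \<noteq> {}"
  obtains A B :: "'i \<Rightarrow> real topology" and q
  where "\<And>i. i \<in> I \<Longrightarrow> P (A i)" "\<And>i. i \<in> I \<Longrightarrow> P (B i)"
    "continuous_map (sum_topology A I) (sum_topology B I) q"
    "strong_map (sum_topology A I) (sum_topology B I) q"
    "equivalent_classes (fibres (sum_topology A I) (sum_topology B I) q) (\<Union>i\<in>I. \<D> i)"
proof -
  obtain A B q where *: "\<And>i. i \<in> I \<Longrightarrow> P (A i) \<and> P (B i) \<and> continuous_map (A i) (B i) (q i) \<and>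
      strong_map (A i) (B i) (q i) \<and> equivalent_classes (fibres (A i) (B i) (q i)) (\<D> i)"
    using comp unfolding strong_composition_def by metis
  have onto: "q i ` topspace (A i) = topspace (B i)" if i: "i \<in> I" "i \<noteq> k" for i
  proof (rule subset_antisym)
    show "q i ` topspace (A i) \<subseteq> topspace (B i)"
      using continuous_map_image_subset_topspace *[OF i(1)] by blast
    show "topspace (B i) \<subseteq> q i ` topspace (A i)"
    proof (rule ccontr)
      assume "\<not> ?thesis"
      then obtain b where "b \<in> topspace (B i) - q i ` topspace (A i)" by blast
      then show False using fibre_over_missing_point *[OF i(1)] nonempty[OF i] by metis
    qed
  qed
  let ?q = "\<lambda>(i, a). (i, q i a)"
  have "continuous_map (sum_topology A I) (sum_topology B I) ?q"
    by (rule continuous_map_sum_topology) (use * in blast)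
  moreover have "strong_map (sum_topology A I) (sum_topology B I) ?q"
    by (rule strong_map_sum_topology[where k = k]) (use * onto in blast)+
  moreover have "equivalent_classes (\<Union>i\<in>I. fibres (A i) (B i) (q i)) (\<Union>i\<in>I. \<D> i)"
    by (rule equivalent_classes_UN) (use * in blast)
  then have "equivalent_classes (fibres (sum_topology A I) (sum_topology B I) ?q) (\<Union>i\<in>I. \<D> i)"
    by (rule equivalent_classes_trans[OF fibres_sum_topology])
  ultimately show thesis
    by (rule that[rotated 2]) (use * in blast)+
qed

text \<open>All fibres of the map from the empty space are empty; there is exactly one of them if the
  class has a member and none otherwise.\<close>

lemma strong_composition_empties:
  assumes "P trivial_topology" "P (discrete_topology {0})" and Z: "\<And>X. X \<in> \<Z> \<Longrightarrow> topspace X = {}"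
  shows "strong_composition P \<Z>"
proof -
  define B :: "real topology" where "B = (if \<Z> = {} then trivial_topology else discrete_topology {0})"
  have "P B" using assms by (simp add: B_def)
  have "closed_map trivial_topology B id" "open_map trivial_topology B id"
    by (simp_all add: closed_map_def open_map_def)
  moreover have "finite (topspace B - id ` {})" "card (topspace B - id ` {}) \<le> 1"
    by (simp_all add: B_def)
  ultimately have "strong_map trivial_topology B id"
    by (simp add: strong_map_def)
  moreover have "continuous_map trivial_topology B id" by simp
  moreover have "equivalent_classes (fibres trivial_topology B id) \<Z>"
  proof (rule equivalent_classesI)
    have fib: "fibres trivial_topology B id = (\<lambda>_. trivial_topology) ` topspace B"
      by (simp add: fibres_def)
    have triv: "(trivial_topology :: real topology) homeomorphic_space X" if "X \<in> \<Z>" for X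
      using Z[OF that] homeomorphic_empty_space_eq[OF refl, of X] by (simp add: null_topspace_iff_trivial)
    show "\<exists>Y\<in>\<Z>. X homeomorphic_space Y" if "X \<in> fibres trivial_topology B id" for X
      using that triv unfolding fib by (auto simp: B_def split: if_splits)
    show "\<exists>X\<in>fibres trivial_topology B id. X homeomorphic_space Y" if "Y \<in> \<Z>" for Y
      using that triv[OF that] unfolding fib by (auto simp: B_def)
  qed
  ultimately show ?thesis unfolding strong_composition_def using \<open>P B\<close> assms(1) by blast
qed

section \<open>Approximations on neighbourhoods of fibres\<close>

lemma metrizable_compactum_finite_discrete: "finite S \<Longrightarrow> metrizable_compactum (discrete_topology S)"
  by (simp add: metrizable_compactum_def metrizable_space_discrete_topology compact_space_discrete_topology)

lemma metrizable_compactum_trivial: "metrizable_compactum trivial_topology"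
  using metrizable_compactum_finite_discrete[of "{}"] by simp

lemma embedding_onto_compact_set:
  fixes e :: "'x \<Rightarrow> 'e::real_normed_vector"
  assumes A: "metrizable_compactum A" and e: "continuous_map A euclidean e" "inj_on e (topspace A)"
    and S: "closedin A S"
  shows "compact (e ` S)" and "subtopology A S homeomorphic_space top_of_set (e ` S)"
proof -
  have "compactin A S" using A S closedin_compact_space by (auto simp: metrizable_compactum_def)
  then show "compact (e ` S)" using image_compactin[OF _ e(1)] by auto
  have "embedding_map A euclidean e"
    using continuous_imp_embedding_map[OF e(1) _ _ e(2)] A by (simp add: metrizable_compactum_def)
  then show "subtopology A S homeomorphic_space top_of_set (e ` S)"
    by (rule embedding_map_homeomorphic_subtopology) (use S closedin_subset in blast)
qed

lemma closedin_fibre: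
  assumes "metrizable_compactum B" "continuous_map A B q" "b \<in> topspace B"
  shows "closedin A {a \<in> topspace A. q a = b}"
proof -
  have "closedin B {b}"
    by (rule closedin_Hausdorff_singleton)
      (use assms in \<open>simp_all add: metrizable_compactum_def metrizable_imp_Hausdorff_space\<close>)
  from closedin_continuous_map_preimage[OF assms(2) this] show ?thesis by simp
qed

text \<open>An approximation of \<open>F\<close> by one fibre persists on nearby fibres. It extends to the whole space;
  the extension still maps nearby fibres close to \<open>F\<close> because \<open>q\<close> is closed, and they still come close
  to every point of \<open>F\<close> because \<open>q\<close> is open and a finite net of \<open>F\<close> decides this.\<close>

lemma approximation_near_fibre:
  fixes A :: "'x topology" and B :: "'y topology" and e :: "'x \<Rightarrow> 'e::real_normed_vector"
  assumes A: "metrizable_compactum A" and B: "metrizable_compactum B"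
    and q: "continuous_map A B q" and op: "open_map A B q"
    and e: "continuous_map A euclidean e"
    and b: "b \<in> topspace B" and F: "compact F"
    and "\<epsilon> > 0" and ap: "approximable (e ` {a \<in> topspace A. q a = b}) F (\<epsilon> / 2)"
  shows "\<exists>V N f. openin B V \<and> b \<in> V \<and> V \<subseteq> N \<and> closedin B N \<and> continuous_map A euclidean f \<and>
    (\<forall>a\<in>topspace A. q a \<in> N \<longrightarrow> (\<exists>y\<in>F. dist (f a) y < \<epsilon>)) \<and>
    (\<forall>b'\<in>N. \<forall>y\<in>F. \<exists>a\<in>topspace A. q a = b' \<and> dist (f a) y < \<epsilon>)"
proof -
  define S where "S = {a \<in> topspace A. q a = b}"
  have S: "closedin A S" unfolding S_def by (rule closedin_fibre[OF B q b])
  obtain g u :: "'e \<Rightarrow> real" and \<phi> :: "real \<times> real \<Rightarrow> 'e"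
    where g: "continuous_on (e ` S) g" and u: "continuous_on (e ` S) u" and \<phi>: "continuous_on UNIV \<phi>"
      and near: "\<forall>x\<in>e ` S. \<exists>y\<in>F. dist (\<phi> (g x, u x)) y < \<epsilon> / 2"
      and dense: "\<forall>y\<in>F. \<exists>x\<in>e ` S. dist (\<phi> (g x, u x)) y < \<epsilon> / 2"
    using ap unfolding approximable_def S_def[symmetric] by (elim exE conjE) (rule that)
  have extend: "\<exists>w'. continuous_map A euclideanreal w' \<and> (\<forall>a\<in>S. w' a = w (e a))"
    if w: "continuous_on (e ` S) w" for w :: "'e \<Rightarrow> real"
  proof -
    have "continuous_map (subtopology A S) (top_of_set (e ` S)) e"
      using e by (auto simp: continuous_map_in_subtopology continuous_map_from_subtopology)
    then have c: "continuous_map (subtopology A S) euclideanreal (w \<circ> e)"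
      by (rule continuous_map_compose) (use w in simp)
    have n: "normal_space A" using A metrizable_imp_normal_space by (auto simp: metrizable_compactum_def)
    obtain w' where "continuous_map A euclideanreal w'" "\<And>x. x \<in> S \<Longrightarrow> w' x = (w \<circ> e) x"
      using Tietze_extension_realinterval[OF n S is_interval_univ UNIV_not_empty c subset_UNIV] by metis
    then show ?thesis by auto
  qed
  obtain g' where g': "continuous_map A euclideanreal g'" "\<forall>a\<in>S. g' a = g (e a)"
    using extend[OF g] by blast
  obtain u' where u': "continuous_map A euclideanreal u'" "\<forall>a\<in>S. u' a = u (e a)"
    using extend[OF u] by blast
  define f where "f = \<phi> \<circ> (\<lambda>a. (g' a, u' a))"
  have "continuous_map A euclidean (\<lambda>a. (g' a, u' a))"
    unfolding prod_topology_euclidean[symmetric] by (intro continuous_map_pairedI g' u')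
  then have f: "continuous_map A euclidean f"
    unfolding f_def by (rule continuous_map_compose) (use \<phi> in simp)
  have fS: "f a = \<phi> (g (e a), u (e a))" if "a \<in> S" for a
    using that g' u' by (simp add: f_def)
  \<comment> \<open>The points all of whose preimages are mapped into the \<open>\<epsilon>\<close>-neighbourhood of \<open>F\<close>.\<close>
  define W1 where "W1 = topspace B - q ` (topspace A - {a \<in> topspace A. f a \<in> (\<Union>y\<in>F. ball y \<epsilon>)})"
  have "openin A {a \<in> topspace A. f a \<in> (\<Union>y\<in>F. ball y \<epsilon>)}"
    by (rule openin_continuous_map_preimage[OF f]) auto
  then have "closedin A (topspace A - {a \<in> topspace A. f a \<in> (\<Union>y\<in>F. ball y \<epsilon>)})" by blast
  moreover have "closed_map A B q"
    using continuous_imp_closed_map[OF q] A B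
    by (simp add: metrizable_compactum_def metrizable_imp_Hausdorff_space)
  ultimately have W1: "openin B W1" unfolding W1_def closed_map_def by blast
  have bW1: "b \<in> W1"
  proof -
    have "f a \<in> (\<Union>y\<in>F. ball y \<epsilon>)" if "a \<in> topspace A" "q a = b" for a
    proof -
      have "a \<in> S" using that by (simp add: S_def)
      then obtain y where "y \<in> F" "dist (\<phi> (g (e a), u (e a))) y < \<epsilon> / 2" using near by blast
      then have "y \<in> F" "dist (f a) y < \<epsilon> / 2" using fS \<open>a \<in> S\<close> by simp_all
      then show ?thesis using \<open>\<epsilon> > 0\<close> by (intro UN_I[of y]) (auto simp: dist_commute)
    qed
    then show ?thesis using b by (auto simp: W1_def)
  qed
  have "\<epsilon> / 2 > 0" using \<open>\<epsilon> > 0\<close> by simp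
  then obtain N0 where N0: "finite N0" "N0 \<subseteq> F" "F \<subseteq> (\<Union>y\<in>N0. ball y (\<epsilon> / 2))"
    by (rule finite_net[OF F])
  \<comment> \<open>The points with some preimage that is mapped close to \<open>y\<close>.\<close>
  define O' where "O' y = q ` {a \<in> topspace A. f a \<in> ball y (\<epsilon> / 2)}" for y
  have O': "openin B (O' y)" for y
  proof -
    have "openin A {a \<in> topspace A. f a \<in> ball y (\<epsilon> / 2)}"
      by (rule openin_continuous_map_preimage[OF f]) auto
    then show ?thesis using op unfolding O'_def open_map_def by blast
  qed
  have bO': "b \<in> O' y" if "y \<in> N0" for y
  proof -
    have "y \<in> F" using that N0(2) by blast
    then obtain a where "a \<in> S" "dist (\<phi> (g (e a), u (e a))) y < \<epsilon> / 2" using dense by blast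
    then have "a \<in> topspace A" "f a \<in> ball y (\<epsilon> / 2)" "b = q a"
      using fS by (simp_all add: S_def dist_commute)
    then show ?thesis unfolding O'_def by blast
  qed
  define W where "W = W1 \<inter> ((\<Inter>y\<in>N0. O' y) \<inter> topspace B)"
  have "openin B W" unfolding W_def using W1 O' N0(1) by (intro openin_Int openin_INT) auto
  moreover have "b \<in> W" using bW1 bO' b by (auto simp: W_def)
  moreover have "neighbourhood_base_of (closedin B) B"
    using B metrizable_imp_regular_space by (auto simp: neighbourhood_base_of_closedin metrizable_compactum_def)
  ultimately obtain V N where VN: "openin B V" "closedin B N" "b \<in> V" "V \<subseteq> N" "N \<subseteq> W"
    unfolding neighbourhood_base_of by metis
  have "\<exists>y\<in>F. dist (f a) y < \<epsilon>" if "a \<in> topspace A" "q a \<in> N" for a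
  proof -
    have "q a \<in> W1" using that VN by (auto simp: W_def)
    then have "f a \<in> (\<Union>y\<in>F. ball y \<epsilon>)" using that by (auto simp: W1_def)
    then show ?thesis by (auto simp: dist_commute)
  qed
  moreover have "\<exists>a\<in>topspace A. q a = b' \<and> dist (f a) y < \<epsilon>" if b': "b' \<in> N" and y: "y \<in> F" for b' y
  proof -
    obtain y0 where y0: "y0 \<in> N0" "dist y0 y < \<epsilon> / 2" using N0(3) y by auto
    then have "b' \<in> O' y0" using b' VN by (auto simp: W_def)
    then obtain a where a: "a \<in> topspace A" "q a = b'" "dist y0 (f a) < \<epsilon> / 2" by (auto simp: O'_def)
    have "dist (f a) y \<le> dist y0 (f a) + dist y0 y" using dist_triangle3[of "f a" y y0] by simp
    then show ?thesis using a y0 by (intro bexI[of _ a]) auto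
  qed
  ultimately show ?thesis using VN f by blast
qed

lemma finite_cover_by_approximations:
  fixes A :: "'x topology" and B :: "'y topology" and e :: "'x \<Rightarrow> 'e::real_normed_vector"
  assumes A: "metrizable_compactum A" and B: "metrizable_compactum B"
    and q: "continuous_map A B q" and op: "open_map A B q"
    and e: "continuous_map A euclidean e"
    and \<J>: "\<And>F. F \<in> \<J> \<Longrightarrow> compact F"
    and ap: "\<And>b. b \<in> topspace B \<Longrightarrow> \<exists>F\<in>\<J>. \<forall>\<epsilon>>0. approximable (e ` {a \<in> topspace A. q a = b}) F \<epsilon>"
    and "\<epsilon> > 0"
  shows "\<exists>(S :: 'y set) N f F. finite S \<and> topspace B = (\<Union>b\<in>S. N b) \<and>
    (\<forall>b\<in>S. closedin B (N b) \<and> continuous_map A euclidean (f b) \<and> F b \<in> \<J> \<and>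
      (\<forall>a\<in>topspace A. q a \<in> N b \<longrightarrow> (\<exists>y\<in>F b. dist (f b a) y < \<epsilon>)) \<and>
      (\<forall>b'\<in>N b. \<forall>y\<in>F b. \<exists>a\<in>topspace A. q a = b' \<and> dist (f b a) y < \<epsilon>))"
proof -
  define G where "G b V N f F \<longleftrightarrow> openin B V \<and> b \<in> V \<and> V \<subseteq> N \<and> closedin B N \<and>
      continuous_map A euclidean f \<and> F \<in> \<J> \<and>
      (\<forall>a\<in>topspace A. q a \<in> N \<longrightarrow> (\<exists>y\<in>F. dist (f a) y < \<epsilon>)) \<and>
      (\<forall>b'\<in>N. \<forall>y\<in>F. \<exists>a\<in>topspace A. q a = b' \<and> dist (f a) y < \<epsilon>)"
    for b V N F and f :: "'x \<Rightarrow> 'e"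
  have "\<exists>V N f F. G b V N f F" if b: "b \<in> topspace B" for b
  proof -
    obtain F where F: "F \<in> \<J>" "\<forall>\<epsilon>>0. approximable (e ` {a \<in> topspace A. q a = b}) F \<epsilon>"
      using ap[OF b] by blast
    have "approximable (e ` {a \<in> topspace A. q a = b}) F (\<epsilon> / 2)" using F(2) \<open>\<epsilon> > 0\<close> by simp
    from approximation_near_fibre[OF A B q op e b \<J>[OF F(1)] \<open>\<epsilon> > 0\<close> this]
    obtain V N and f :: "'x \<Rightarrow> 'e" where "openin B V \<and> b \<in> V \<and> V \<subseteq> N \<and> closedin B N \<and>
      continuous_map A euclidean f \<and>
      (\<forall>a\<in>topspace A. q a \<in> N \<longrightarrow> (\<exists>y\<in>F. dist (f a) y < \<epsilon>)) \<and>
      (\<forall>b'\<in>N. \<forall>y\<in>F. \<exists>a\<in>topspace A. q a = b' \<and> dist (f a) y < \<epsilon>)"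
      by (elim exE)
    then have "G b V N f F" using F(1) by (simp add: G_def)
    then show ?thesis by blast
  qed
  then obtain V N f F where G: "\<And>b. b \<in> topspace B \<Longrightarrow> G b (V b) (N b) (f b) (F b)" by metis
  have "compactin B (topspace B)" using B by (simp add: metrizable_compactum_def compact_space_def)
  moreover have "\<forall>U\<in>V ` topspace B. openin B U" "topspace B \<subseteq> \<Union>(V ` topspace B)"
  proof -
    have "openin B (V b) \<and> b \<in> V b" if "b \<in> topspace B" for b
      using G[OF that] by (simp add: G_def)
    then show "\<forall>U\<in>V ` topspace B. openin B U" "topspace B \<subseteq> \<Union>(V ` topspace B)" by blast+
  qed
  ultimately have "\<exists>\<F>. finite \<F> \<and> \<F> \<subseteq> V ` topspace B \<and> topspace B \<subseteq> \<Union>\<F>"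
    unfolding compactin_def by (elim conjE allE[where x = "V ` topspace B"]) simp
  then obtain \<F> where \<F>: "finite \<F>" "\<F> \<subseteq> V ` topspace B" "topspace B \<subseteq> \<Union>\<F>" by blast
  then obtain S where S: "S \<subseteq> topspace B" "finite S" "\<F> = V ` S" using finite_subset_image by metis
  have "topspace B = (\<Union>b\<in>S. N b)"
  proof (intro subset_antisym UN_least)
    have VN: "V b \<subseteq> N b" "closedin B (N b)" if "b \<in> S" for b
      using G[of b] S(1) that unfolding G_def by (simp_all add: subsetD)
    then show "topspace B \<subseteq> (\<Union>b\<in>S. N b)" using \<F>(3) S(3) by blast
    show "N b \<subseteq> topspace B" if "b \<in> S" for b
      using closedin_subset[OF VN(2)[OF that]] .
  qed
  moreover have "\<forall>b\<in>S. closedin B (N b) \<and> continuous_map A euclidean (f b) \<and> F b \<in> \<J> \<and>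
      (\<forall>a\<in>topspace A. q a \<in> N b \<longrightarrow> (\<exists>y\<in>F b. dist (f b a) y < \<epsilon>)) \<and>
      (\<forall>b'\<in>N b. \<forall>y\<in>F b. \<exists>a\<in>topspace A. q a = b' \<and> dist (f b a) y < \<epsilon>)"
  proof
    fix b assume "b \<in> S"
    then have "G b (V b) (N b) (f b) (F b)" using G S(1) by blast
    then show "closedin B (N b) \<and> continuous_map A euclidean (f b) \<and> F b \<in> \<J> \<and>
      (\<forall>a\<in>topspace A. q a \<in> N b \<longrightarrow> (\<exists>y\<in>F b. dist (f b a) y < \<epsilon>)) \<and>
      (\<forall>b'\<in>N b. \<forall>y\<in>F b. \<exists>a\<in>topspace A. q a = b' \<and> dist (f b a) y < \<epsilon>)"
      unfolding G_def by (elim conjE) (intro conjI; assumption)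
  qed
  ultimately have "finite S \<and> topspace B = (\<Union>b\<in>S. N b) \<and>
    (\<forall>b\<in>S. closedin B (N b) \<and> continuous_map A euclidean (f b) \<and> F b \<in> \<J> \<and>
      (\<forall>a\<in>topspace A. q a \<in> N b \<longrightarrow> (\<exists>y\<in>F b. dist (f b a) y < \<epsilon>)) \<and>
      (\<forall>b'\<in>N b. \<forall>y\<in>F b. \<exists>a\<in>topspace A. q a = b' \<and> dist (f b a) y < \<epsilon>))"
    using S(2) by (intro conjI)
  then show ?thesis by (intro exI[of _ S] exI[of _ N] exI[of _ f] exI[of _ F])
qed

section \<open>Countable unions\<close>

text \<open>The base of the \<open>n\<close>-th composition is cut into finitely many closed pieces, over each of which
  the fibres approximate one of the finitely many limits \<open>Z \<in> \<J>\<close> with error \<open>w n\<close>. For fixed \<open>Z\<close> the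
  pieces form a null sequence with limit \<open>Z\<close>. The limit is itself a fibre, so that nothing is added
  to the class. It remains to take the sum over \<open>\<J>\<close>.\<close>

lemma strongly_compactifiable_UN_nonempty:
  fixes \<C> :: "'i \<Rightarrow> 'a topology set"
  assumes I: "countable I" and sc: "\<And>n. n \<in> I \<Longrightarrow> strongly_compactifiable (\<C> n)"
    and nonempty: "\<And>n X. n \<in> I \<Longrightarrow> X \<in> \<C> n \<Longrightarrow> topspace X \<noteq> {}"
  shows "strongly_compactifiable (\<Union>n\<in>I. \<C> n)"
proof -
  obtain A B :: "'i \<Rightarrow> real topology" and q where *: "\<And>n. n \<in> I \<Longrightarrow> metrizable_compactum (A n) \<and>
      metrizable_compactum (B n) \<and> continuous_map (A n) (B n) (q n) \<and> strong_map (A n) (B n) (q n) \<and>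
      equivalent_classes (fibres (A n) (B n) (q n)) (\<C> n)"
    using sc unfolding strongly_compactifiable_def by metis
  have A: "metrizable_compactum (A n)" and B: "metrizable_compactum (B n)"
    and q: "continuous_map (A n) (B n) (q n)" and s: "strong_map (A n) (B n) (q n)"
    and eq: "equivalent_classes (fibres (A n) (B n) (q n)) (\<C> n)" if "n \<in> I" for n
    using *[OF that] by blast+
  have op: "open_map (A n) (B n) (q n)" if "n \<in> I" for n using s[OF that] by (simp add: strong_map_def)
  have "\<exists>e :: real \<Rightarrow> (nat \<Rightarrow>\<^sub>C real). continuous_map (A n) euclidean e \<and> inj_on e (topspace (A n))"
    if "n \<in> I" for n
    using metrizable_compactum_embedding[OF A[OF that]] by metis
  then obtain e :: "'i \<Rightarrow> real \<Rightarrow> (nat \<Rightarrow>\<^sub>C real)" where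
    e: "\<And>n. n \<in> I \<Longrightarrow> continuous_map (A n) euclidean (e n)" "\<And>n. n \<in> I \<Longrightarrow> inj_on (e n) (topspace (A n))"
    by metis
  define S where "S n b = {a \<in> topspace (A n). q n a = b}" for n b
  define fib where "fib n b = subtopology (A n) (S n b)" for n b
  have fibres: "fibres (A n) (B n) (q n) = fib n ` topspace (B n)" for n
    by (simp add: fibres_def fib_def[abs_def] S_def)
  have S_closed: "closedin (A n) (S n b)" if "n \<in> I" "b \<in> topspace (B n)" for n b
    unfolding S_def using closedin_fibre[OF B q] that by blast
  have S_nonempty: "S n b \<noteq> {}" if n: "n \<in> I" and b: "b \<in> topspace (B n)" for n b
  proof
    assume "S n b = {}"
    then have "b \<in> topspace (B n) - q n ` topspace (A n)" using b by (auto simp: S_def)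
    then obtain X where "X \<in> \<C> n" "topspace X = {}"
      using fibre_over_missing_point[OF eq[OF n]] by blast
    then show False using nonempty n by blast
  qed
  define \<K> where "\<K> = {e n ` S n b | n b. n \<in> I \<and> b \<in> topspace (B n)}"
  have \<K>: "compact K \<and> K \<noteq> {}" if K: "K \<in> \<K>" for K
  proof -
    obtain n b where nb: "n \<in> I" "b \<in> topspace (B n)" "K = e n ` S n b" using K by (auto simp: \<K>_def)
    then show ?thesis
      using embedding_onto_compact_set(1)[OF A e S_closed] S_nonempty by simp
  qed
  obtain \<J> where \<J>: "\<J> \<subseteq> \<K>" "finite \<J>"
    and ap: "\<And>K. K \<in> \<K> \<Longrightarrow> \<exists>F\<in>\<J>. \<forall>\<epsilon>>0. approximable K F \<epsilon>"
    using finitely_many_limits[OF \<K>] by metis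
  define w where "w n = 1 / (real (to_nat_on I n) + 1)" for n
  have w0: "w n > 0" for n by (simp add: w_def add_pos_nonneg)
  define P where "P n T N f F \<longleftrightarrow> finite T \<and> topspace (B n) = (\<Union>b\<in>T. N b) \<and>
    (\<forall>b\<in>T. closedin (B n) (N b) \<and> continuous_map (A n) euclidean (f b) \<and> F b \<in> \<J> \<and>
      (\<forall>a\<in>topspace (A n). q n a \<in> N b \<longrightarrow> (\<exists>y\<in>F b. dist (f b a) y < w n)) \<and>
      (\<forall>b'\<in>N b. \<forall>y\<in>F b. \<exists>a\<in>topspace (A n). q n a = b' \<and> dist (f b a) y < w n))"
    for n T N F and f :: "real \<Rightarrow> real \<Rightarrow> (nat \<Rightarrow>\<^sub>C real)"
  have "\<exists>T N f F. P n T N f F" if n: "n \<in> I" for n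
    unfolding P_def
  proof (rule finite_cover_by_approximations[OF A[OF n] B[OF n] q[OF n] op[OF n] e(1)[OF n]])
    show "compact F" if "F \<in> \<J>" for F using that \<J>(1) \<K> by blast
    show "\<exists>F\<in>\<J>. \<forall>\<epsilon>>0. approximable (e n ` {a \<in> topspace (A n). q n a = b}) F \<epsilon>"
      if "b \<in> topspace (B n)" for b
      using ap[of "e n ` S n b"] n that unfolding \<K>_def S_def by blast
  qed (rule w0)
  then obtain T N f F where P: "\<And>n. n \<in> I \<Longrightarrow> P n (T n) (N n) (f n) (F n)" by metis
  have T: "finite (T n)" "topspace (B n) = (\<Union>b\<in>T n. N n b)" if "n \<in> I" for n
    using P[OF that] by (simp_all add: P_def)
  have piece: "closedin (B n) (N n b) \<and> continuous_map (A n) euclidean (f n b) \<and> F n b \<in> \<J> \<and>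
      (\<forall>a\<in>topspace (A n). q n a \<in> N n b \<longrightarrow> (\<exists>y\<in>F n b. dist (f n b a) y < w n)) \<and>
      (\<forall>b'\<in>N n b. \<forall>y\<in>F n b. \<exists>a\<in>topspace (A n). q n a = b' \<and> dist (f n b a) y < w n)"
    if "n \<in> I" "b \<in> T n" for n b
    using P[OF that(1)] that(2) unfolding P_def by blast
  \<comment> \<open>The pieces whose fibres approximate \<open>Z\<close>.\<close>
  define M where "M Z = {(n, b). n \<in> I \<and> b \<in> T n \<and> F n b = Z}" for Z
  have N_sub: "N n b \<subseteq> topspace (B n)" if "n \<in> I" "b \<in> T n" for n b
    using piece[OF that] closedin_subset by blast
  have "\<exists>n b. n \<in> I \<and> b \<in> topspace (B n) \<and> Z = e n ` S n b" if "Z \<in> \<J>" for Z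
    using that \<J>(1) unfolding \<K>_def by blast
  then obtain l c where lc: "\<And>Z. Z \<in> \<J> \<Longrightarrow> l Z \<in> I \<and> c Z \<in> topspace (B (l Z)) \<and> Z = e (l Z) ` S (l Z) (c Z)"
    by metis
  define \<D> where "\<D> Z = insert (fib (l Z) (c Z)) (\<Union>(n, b)\<in>M Z. fib n ` N n b)" for Z
  have D_sc: "strongly_compactifiable (\<D> Z)" if Z: "Z \<in> \<J>" for Z
  proof -
    let ?A = "\<lambda>(n, b). subtopology (A n) {a \<in> topspace (A n). q n a \<in> N n b}"
    let ?B = "\<lambda>(n, b). subtopology (B n) (N n b)"
    let ?q = "\<lambda>(n, b). q n"
    let ?f = "\<lambda>(n, b). f n b"
    let ?w = "\<lambda>(n, b). w n"
    have M: "n \<in> I" "b \<in> T n" "F n b = Z" if "(n, b) \<in> M Z" for n b using that by (auto simp: M_def)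
    have countM: "countable (M Z)"
    proof (rule countable_subset)
      show "M Z \<subseteq> Sigma I T" by (auto simp: M_def)
      show "countable (Sigma I T)" using I T by (intro countable_SIGMA) (auto intro: countable_finite)
    qed
    have pre: "closedin (A n) {a \<in> topspace (A n). q n a \<in> N n b}" if "(n, b) \<in> M Z" for n b
      using closedin_continuous_map_preimage[OF q] piece M[OF that] by blast
    have fib_piece: "fibres (?A m) (?B m) (?q m) = (\<lambda>(n, b). fib n ` N n b) m" if mM: "m \<in> M Z" for m
    proof -
      obtain n b where m: "m = (n, b)" "(n, b) \<in> M Z" using mM by (cases m) auto
      have "{a \<in> topspace (A n). q n a \<in> N n b} \<inter> {a \<in> topspace (A n) \<inter> {a \<in> topspace (A n). q n a \<in> N n b}. q n a = y} = S n y"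
        if "y \<in> N n b" for y using that by (auto simp: S_def)
      then show ?thesis
        using N_sub[OF M(1,2)[OF m(2)]]
        by (auto simp: m fibres_def fib_def subtopology_subtopology inf.absorb2 intro!: image_cong)
    qed
    have q_piece: "continuous_map (?A m) (?B m) (?q m)" "open_map (?A m) (?B m) (?q m)" if mM: "m \<in> M Z" for m
    proof -
      obtain n b where m: "m = (n, b)" "(n, b) \<in> M Z" using mM by (cases m) auto
      show "continuous_map (?A m) (?B m) (?q m)"
        using q[OF M(1)[OF m(2)]] by (auto simp: m continuous_map_in_subtopology continuous_map_from_subtopology)
      show "open_map (?A m) (?B m) (?q m)"
        using open_map_restriction[OF op[OF M(1)[OF m(2)]]] by (simp add: m)
    qed
    have "strongly_compactifiable (insert (fib (l Z) (c Z)) (\<Union>m\<in>M Z. fibres (?A m) (?B m) (?q m)))"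
    proof (rule null_sequence_of_families(2)[of "M Z" ?A ?B ?q ?f Z "fib (l Z) (c Z)" ?w])
      show "countable (M Z)" by (rule countM)
      show "compact Z" "Z \<noteq> {}" using Z \<J>(1) \<K> by blast+
      show "fib (l Z) (c Z) homeomorphic_space top_of_set Z"
        using embedding_onto_compact_set(2)[OF A e S_closed, of "l Z" "c Z"] lc[OF Z] by (simp add: fib_def)
      fix m assume "m \<in> M Z"
      then obtain n b where m: "m = (n, b)" "(n, b) \<in> M Z" by (cases m) auto
      note nb = M[OF m(2)] and pc = piece[OF M(1,2)[OF m(2)]]
      show "metrizable_compactum (?A m)" using metrizable_compactum_closedin[OF A[OF nb(1)] pre[OF m(2)]] by (simp add: m)
      show "metrizable_compactum (?B m)" using metrizable_compactum_closedin[OF B[OF nb(1)]] pc by (simp add: m)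
      show "continuous_map (?A m) (?B m) (?q m)" using q_piece(1)[of "(n, b)"] m by simp
      show "continuous_map (?A m) euclidean (?f m)" using pc by (simp add: m continuous_map_from_subtopology)
      show "\<exists>x\<in>Z. dist (?f m a) x < ?w m" if "a \<in> topspace (?A m)" for a
        using pc that nb(3) by (simp add: m)
    next
      fix \<delta> :: real assume "\<delta> > 0"
      show "finite {m \<in> M Z. \<delta> \<le> ?w m}"
      proof (rule finite_subset)
        show "{m \<in> M Z. \<delta> \<le> ?w m} \<subseteq> Sigma {n \<in> I. \<delta> \<le> w n} T" by (auto simp: M_def)
        show "finite (Sigma {n \<in> I. \<delta> \<le> w n} T)"
          using finite_large_weights[OF I \<open>\<delta> > 0\<close>] T(1) by (intro finite_SigmaI) (auto simp: w_def)
      qed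
    next
      show "open_map (?A m) (?B m) (?q m)" if "m \<in> M Z" for m using q_piece(2)[OF that] .
      fix m y x assume my: "m \<in> M Z" "y \<in> topspace (?B m)" "x \<in> Z"
      then obtain n b where m: "m = (n, b)" "(n, b) \<in> M Z" by (cases m) auto
      then have "y \<in> N n b" using my(2) by simp
      moreover have "x \<in> F n b" using M(3)[OF m(2)] my(3) by simp
      ultimately obtain a where "a \<in> topspace (A n)" "q n a = y" "dist (f n b a) x < w n"
        using piece[OF M(1,2)[OF m(2)]] by blast
      then show "\<exists>a\<in>topspace (?A m). ?q m a = y \<and> dist (?f m a) x < ?w m"
        using \<open>y \<in> N n b\<close> by (intro bexI[of _ a]) (simp_all add: m)
    qed
    moreover have "insert (fib (l Z) (c Z)) (\<Union>m\<in>M Z. fibres (?A m) (?B m) (?q m)) = \<D> Z"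
      unfolding \<D>_def using fib_piece by simp
    ultimately show ?thesis by (simp only:)
  qed
  have "\<exists>n\<in>I. \<exists>b\<in>topspace (B n). X = fib n b" if "Z \<in> \<J>" "X \<in> \<D> Z" for X Z
    using that lc[OF that(1)] N_sub unfolding \<D>_def M_def by blast
  then have sub: "\<D> Z \<subseteq> (\<Union>n\<in>I. fib n ` topspace (B n))" if "Z \<in> \<J>" for Z using that by blast
  have sup: "fib n b \<in> (\<Union>Z\<in>\<J>. \<D> Z)" if n: "n \<in> I" "b \<in> topspace (B n)" for n b
  proof -
    obtain b' where b': "b' \<in> T n" "b \<in> N n b'" using T(2) n by blast
    then have "F n b' \<in> \<J>" "(n, b') \<in> M (F n b')" using piece[OF n(1) b'(1)] n(1) by (auto simp: M_def)
    then show ?thesis using b'(2) unfolding \<D>_def by blast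
  qed
  have union: "(\<Union>Z\<in>\<J>. \<D> Z) = (\<Union>n\<in>I. fibres (A n) (B n) (q n))"
    unfolding fibres using sub sup by blast
  have D_nonempty: "topspace X \<noteq> {}" if Z: "Z \<in> \<J>" and X: "X \<in> \<D> Z" for X Z
  proof -
    obtain n b where nb: "n \<in> I" "b \<in> topspace (B n)" "X = fib n b" using sub[OF Z] X by blast
    then have "topspace X = S n b" using closedin_subset[OF S_closed[OF nb(1,2)]] by (auto simp: fib_def)
    then show ?thesis using S_nonempty nb by simp
  qed
  obtain AA BB :: "(nat \<Rightarrow>\<^sub>C real) set \<Rightarrow> real topology" and qq
    where AB: "\<And>Z. Z \<in> \<J> \<Longrightarrow> metrizable_compactum (AA Z)" "\<And>Z. Z \<in> \<J> \<Longrightarrow> metrizable_compactum (BB Z)"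
    "continuous_map (sum_topology AA \<J>) (sum_topology BB \<J>) qq"
    "strong_map (sum_topology AA \<J>) (sum_topology BB \<J>) qq"
    "equivalent_classes (fibres (sum_topology AA \<J>) (sum_topology BB \<J>) qq) (\<Union>Z\<in>\<J>. \<D> Z)"
    using strong_composition_sum[of \<J> metrizable_compactum \<D>] D_sc D_nonempty
    unfolding strongly_compactifiable_iff by metis
  have "equivalent_classes (\<Union>Z\<in>\<J>. \<D> Z) (\<Union>n\<in>I. \<C> n)"
    unfolding union by (rule equivalent_classes_UN) (rule eq)
  then show ?thesis
    using strongly_compactifiableI[OF metrizable_compactum_sum_topology[OF \<J>(2) AB(1)]
        metrizable_compactum_sum_topology[OF \<J>(2) AB(2)] AB(3,4)] equivalent_classes_trans[OF AB(5)] by blast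
qed

text \<open>The empty spaces are split off because several compositions may each have a missed point.\<close>

lemma strongly_compactifiable_UN:
  fixes \<C> :: "'i \<Rightarrow> 'a topology set"
  assumes I: "countable I" and sc: "\<And>n. n \<in> I \<Longrightarrow> strongly_compactifiable (\<C> n)"
  shows "strongly_compactifiable (\<Union>n\<in>I. \<C> n)"
proof -
  define \<D> where "\<D> empty = {X \<in> (\<Union>n\<in>I. \<C> n). (topspace X = {}) = empty}" for empty :: bool
  have "strong_composition metrizable_compactum (\<D> True)"
    using metrizable_compactum_finite_discrete[of "{0 :: real}"] metrizable_compactum_trivial
    by (intro strong_composition_empties) (auto simp: \<D>_def)
  moreover have "strong_composition metrizable_compactum (\<D> False)"
  proof -
    have "strongly_compactifiable {X \<in> \<C> n. topspace X \<noteq> {}}" if "n \<in> I" for n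
      using sc[OF that] metrizable_compactum_closedin unfolding strongly_compactifiable_iff
      by (intro strong_composition_nonempty_part)
    then have "strongly_compactifiable (\<Union>n\<in>I. {X \<in> \<C> n. topspace X \<noteq> {}})"
      by (intro strongly_compactifiable_UN_nonempty[OF I]) auto
    moreover have "(\<Union>n\<in>I. {X \<in> \<C> n. topspace X \<noteq> {}}) = \<D> False" by (auto simp: \<D>_def)
    ultimately show ?thesis by (simp add: strongly_compactifiable_iff)
  qed
  ultimately have D: "strong_composition metrizable_compactum (\<D> i)" for i by (cases i) auto
  have ne: "topspace X \<noteq> {}" if "i \<noteq> True" "X \<in> \<D> i" for i X using that by (auto simp: \<D>_def)
  obtain A B :: "bool \<Rightarrow> real topology" and q
    where AB: "\<And>i. i \<in> UNIV \<Longrightarrow> metrizable_compactum (A i)" "\<And>i. i \<in> UNIV \<Longrightarrow> metrizable_compactum (B i)"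
    "continuous_map (sum_topology A UNIV) (sum_topology B UNIV) q"
    "strong_map (sum_topology A UNIV) (sum_topology B UNIV) q"
    "equivalent_classes (fibres (sum_topology A UNIV) (sum_topology B UNIV) q) (\<Union>i\<in>UNIV. \<D> i)"
    using strong_composition_sum[of UNIV metrizable_compactum \<D> True] D ne by metis
  have "(\<Union>i\<in>UNIV. \<D> i) = (\<Union>n\<in>I. \<C> n)" by (auto simp: \<D>_def UNIV_bool)
  then show ?thesis
    using strongly_compactifiableI[OF metrizable_compactum_sum_topology[OF finite AB(1)]
        metrizable_compactum_sum_topology[OF finite AB(2)] AB(3,4)] AB(5) by metis
qed

lemma strongly_Polishable_UN:
  fixes \<C> :: "'i \<Rightarrow> 'a topology set"
  assumes I: "countable I" and sp: "\<And>n. n \<in> I \<Longrightarrow> strongly_Polishable (\<C> n)"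
  shows "strongly_Polishable (\<Union>n\<in>I. \<C> n)"
proof -
  define \<D> where "\<D> i = (case i of None \<Rightarrow> {X \<in> (\<Union>n\<in>I. \<C> n). topspace X = {}}
    | Some n \<Rightarrow> {X \<in> \<C> n. topspace X \<noteq> {}})" for i
  define J where "J = insert None (Some ` I)"
  have "strong_composition polish_space (\<D> None)"
    using metrizable_compactum_finite_discrete[of "{0 :: real}"] metrizable_compactum_trivial
    by (intro strong_composition_empties) (auto simp: \<D>_def metrizable_compactum_iff_polish)
  moreover have "strong_composition polish_space (\<D> (Some n))" if "n \<in> I" for n
    using sp[OF that] polish_space_clopenin unfolding strongly_Polishable_iff \<D>_def option.case
    by (intro strong_composition_nonempty_part)
  ultimately have D: "strong_composition polish_space (\<D> i)" if "i \<in> J" for i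
    using that by (auto simp: J_def)
  have ne: "topspace X \<noteq> {}" if "i \<in> J" "i \<noteq> None" "X \<in> \<D> i" for i X
    using that by (auto simp: \<D>_def)
  obtain A B :: "'i option \<Rightarrow> real topology" and q
    where AB: "\<And>i. i \<in> J \<Longrightarrow> polish_space (A i)" "\<And>i. i \<in> J \<Longrightarrow> polish_space (B i)"
    "continuous_map (sum_topology A J) (sum_topology B J) q"
    "strong_map (sum_topology A J) (sum_topology B J) q"
    "equivalent_classes (fibres (sum_topology A J) (sum_topology B J) q) (\<Union>i\<in>J. \<D> i)"
    using strong_composition_sum[of J polish_space \<D> None] D ne by metis
  have "(\<Union>i\<in>J. \<D> i) = (\<Union>n\<in>I. \<C> n)" by (auto simp: \<D>_def J_def)
  moreover have "countable J" using I by (simp add: J_def)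
  ultimately show ?thesis
    using strongly_PolishableI[OF polish_space_sum_topology[OF _ AB(1)]
        polish_space_sum_topology[OF _ AB(2)] AB(3,4)] AB(5) by metis
qed

lemma Polishable_UN:
  fixes \<C> :: "'i \<Rightarrow> 'a topology set"
  assumes I: "countable I" and P: "\<And>n. n \<in> I \<Longrightarrow> Polishable (\<C> n)"
  shows "Polishable (\<Union>n\<in>I. \<C> n)"
proof -
  obtain A B :: "'i \<Rightarrow> real topology" and q where *: "\<And>n. n \<in> I \<Longrightarrow> polish_space (A n) \<and>
      polish_space (B n) \<and> continuous_map (A n) (B n) (q n) \<and>
      equivalent_classes (fibres (A n) (B n) (q n)) (\<C> n)"
    using P unfolding Polishable_def by metis
  let ?q = "\<lambda>(n, a). (n, q n a)"
  have "polish_space (sum_topology A I)" "polish_space (sum_topology B I)"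
    using * by (auto intro!: polish_space_sum_topology[OF I])
  moreover have "continuous_map (sum_topology A I) (sum_topology B I) ?q"
    by (rule continuous_map_sum_topology) (use * in blast)
  moreover have "equivalent_classes (\<Union>n\<in>I. fibres (A n) (B n) (q n)) (\<Union>n\<in>I. \<C> n)"
    by (rule equivalent_classes_UN) (use * in blast)
  ultimately show ?thesis
    using PolishableI equivalent_classes_trans[OF fibres_sum_topology] by blast
qed

text \<open>Openness is not at stake here, so all compositions may shrink to one point of a single nonempty
  fibre. If all members of the classes are empty,
  the map from the empty space to at most one point is a composition.\<close>

lemma compactifiable_UN:
  fixes \<C> :: "'i \<Rightarrow> 'a topology set"
  assumes I: "countable I" and C: "\<And>n. n \<in> I \<Longrightarrow> compactifiable (\<C> n)"
  shows "compactifiable (\<Union>n\<in>I. \<C> n)"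
proof (cases "\<exists>n\<in>I. \<exists>X\<in>\<C> n. topspace X \<noteq> {}")
  case False
  then have "strong_composition metrizable_compactum (\<Union>n\<in>I. \<C> n)"
    using metrizable_compactum_finite_discrete[of "{0 :: real}"] metrizable_compactum_trivial
    by (intro strong_composition_empties) auto
  then show ?thesis unfolding strong_composition_def compactifiable_def by blast
next
  case True
  obtain A B :: "'i \<Rightarrow> real topology" and q where *: "\<And>n. n \<in> I \<Longrightarrow> metrizable_compactum (A n) \<and>
      metrizable_compactum (B n) \<and> continuous_map (A n) (B n) (q n) \<and>
      equivalent_classes (fibres (A n) (B n) (q n)) (\<C> n)"
    using C unfolding compactifiable_def by metis
  obtain n0 X where n0: "n0 \<in> I" "X \<in> \<C> n0" "topspace X \<noteq> {}" using True by blast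
  obtain X0 where X0: "X0 \<in> fibres (A n0) (B n0) (q n0)" "X homeomorphic_space X0"
    using *[OF n0(1)] n0(2) unfolding equivalent_classes_def by blast
  then obtain b where b: "b \<in> topspace (B n0)" "X0 = subtopology (A n0) {a \<in> topspace (A n0). q n0 a = b}"
    by (auto simp: fibres_def)
  define S where "S = {a \<in> topspace (A n0). q n0 a = b}"
  have "closedin (A n0) S"
    unfolding S_def using * n0(1) b(1) by (intro closedin_fibre[of "B n0"]) auto
  moreover obtain e :: "real \<Rightarrow> (nat \<Rightarrow>\<^sub>C real)"
    where e: "continuous_map (A n0) euclidean e" "inj_on e (topspace (A n0))"
    using metrizable_compactum_embedding *[OF n0(1)] by metis
  ultimately have eS: "compact (e ` S)" "X0 homeomorphic_space top_of_set (e ` S)"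
    using embedding_onto_compact_set[OF _ e] *[OF n0(1)] by (simp_all add: b(2) S_def)
  have "topspace X0 \<noteq> {}" using homeomorphic_space_empty_iff[OF X0(2)] n0(3) by blast
  then obtain y where y: "y \<in> e ` S" by (auto simp: b(2) S_def)
  define w where "w n = 1 / (real (to_nat_on I n) + 1)" for n
  have w0: "w n > 0" for n by (simp add: w_def add_pos_nonneg)
  have "compactifiable (insert X0 (\<Union>n\<in>I. fibres (A n) (B n) (q n)))"
  proof (rule null_sequence_of_families(1)[of I A B q "\<lambda>_ _. y" "e ` S" X0 w])
    show "\<exists>x\<in>e ` S. dist y x < w n" for n using y w0 by (intro bexI[of _ y]) auto
    show "finite {m \<in> I. \<delta> \<le> w m}" if "\<delta> > 0" for \<delta>
      unfolding w_def by (rule finite_large_weights[OF I that])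
    show "e ` S \<noteq> {}" using y by blast
    fix n assume n: "n \<in> I"
    show "metrizable_compactum (A n)" "metrizable_compactum (B n)" "continuous_map (A n) (B n) (q n)"
      using *[OF n] by simp_all
  qed (simp_all add: I eS)
  then obtain A' B' :: "real topology" and q'
    where mc: "metrizable_compactum A'" "metrizable_compactum B'" "continuous_map A' B' q'"
      and eq: "equivalent_classes (fibres A' B' q') (insert X0 (\<Union>n\<in>I. fibres (A n) (B n) (q n)))"
    unfolding compactifiable_def by blast
  have "insert X0 (\<Union>n\<in>I. fibres (A n) (B n) (q n)) = (\<Union>n\<in>I. fibres (A n) (B n) (q n))"
    using X0(1) n0(1) by blast
  moreover have "equivalent_classes (\<Union>n\<in>I. fibres (A n) (B n) (q n)) (\<Union>n\<in>I. \<C> n)"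
    by (rule equivalent_classes_UN) (use * in blast)
  ultimately have "equivalent_classes (fibres A' B' q') (\<Union>n\<in>I. \<C> n)"
    using equivalent_classes_trans[OF eq] by simp
  then show ?thesis by (rule compactifiableI[OF mc])
qed

theorem proposition4p1:
  fixes I :: "'i set" and \<C> :: "'i \<Rightarrow> 'a topology set"
  assumes "countable I"
  shows "((\<forall>n\<in>I. strongly_compactifiable (\<C> n)) \<longrightarrow> strongly_compactifiable (\<Union>n\<in>I. \<C> n)) \<and>
         ((\<forall>n\<in>I. compactifiable (\<C> n)) \<longrightarrow> compactifiable (\<Union>n\<in>I. \<C> n)) \<and>
         ((\<forall>n\<in>I. strongly_Polishable (\<C> n)) \<longrightarrow> strongly_Polishable (\<Union>n\<in>I. \<C> n)) \<and>
         ((\<forall>n\<in>I. Polishable (\<C> n)) \<longrightarrow> Polishable (\<Union>n\<in>I. \<C> n))"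
  using assms strongly_compactifiable_UN[of I \<C>] compactifiable_UN[of I \<C>]
    strongly_Polishable_UN[of I \<C>] Polishable_UN[of I \<C>] by simp

end
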